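(* Fix integers $n \ge 1$, $b \ge 1$, $c\ge 1$ and $u_1\ge 1$, let $\mathbf{u} = (u_1,\ldots,u_n)$ with $u_i = u_1 + (i-1)b$, and let $\lambda = (\lambda_1,\ldots,\lambda_n)$ with $\lambda_i = u_n - u_i + c = (n-i)b + c$. Let $\widetilde{a_n}(c) = \dim_k\left(R/I_W(\mathbf{u})^{[\mathbf{u_n+c-1}]}\right)$. Then $\widetilde{a_n}(c) = \widetilde{a_n}(x)|_{x=c}$ where $$\widetilde{a_n}(x) = \sum_{r=1}^{n} b^{n-r} s(n,r)\, x(x+b)\cdots(x+(r-1)b),$$ and $$|\widetilde{\mathrm{PF}}_n(\lambda)| = \widetilde{a_n}(c) = b^n \sum_{r=1}^n s(n,r) \frac{\Gamma(\frac{c}{b}+r)}{\Gamma(\frac{c}{b})},$$ where $s(n,r)$ is the signless Stirling number of the first kind and $\Gamma$ is the gamma function.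
   Context: $k$ is a field, $R = k[x_1,\ldots,x_n]$, $\mathfrak{S}_n$ the permutations of $[n]$ in one-line notation; $\sigma$ avoids a pattern $\tau$ if no subsequence of $\sigma(1)\cdots\sigma(n)$ has the same relative order as $\tau$. $W = \mathfrak{S}_n(132,312)$. $I_W(\mathbf{u}) = \langle \prod_{i=1}^n x_i^{u_{\sigma(i)}} : \sigma\in W\rangle$. For $\mathbf{a}\in\mathbb{N}^n$ and a monomial ideal $I$ whose minimal generators divide $\mathbf{x}^{\mathbf{a}}$, the Alexander dual is $I^{[\mathbf{a}]} = \bigcap_{\mathbf{x}^{\mathbf{b}}} \mathfrak{m}^{\mathbf{a}\setminus\mathbf{b}}$ over minimal generators $\mathbf{x}^{\mathbf{b}}$ of $I$, with $(\mathbf{a}\setminus\mathbf{b})_i = a_i+1-b_i$ if $b_i\ge1$, $0$ if $b_i=0$, and $\mathfrak{m}^{\mathbf{d}}=\langle x_i^{d_i}: d_i\ge1\rangle$; $\mathbf{u_n+c-1}=(u_n+c-1,\ldots,u_n+c-1)$. A $\lambda$-parking function of length $n$ is $\mathbf{p}=(p_1,\ldots,p_n)\in\mathbb{N}^n$ whose nondecreasing rearrangement $p_{i_1}\le\cdots\le p_{i_n}$ satisfies $p_{i_j} < \lambda_{n-j+1}$ for $1\le j\le n$. For nonempty $T=\{j_1<\cdots<j_t\}\subseteq[n]$ put $\mu^{\mathbf{u}}_{j_1,T} = u_n - u_t + c$ and $\mu^{\mathbf{u}}_{j_s,T} = u_n - u_{t+j_s-s} + c$ for $2\le s\le t$. A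 $\lambda$-parking function $\mathbf{p}$ is a restricted $\lambda$-parking function if there is $\alpha\in\mathfrak{S}_n$ with $p_{\alpha(i)} < \mu^{\mathbf{u}}_{\alpha(i),T_i}$ for all $1\le i\le n$, where $T_1=[n]$ and $T_i = [n]\setminus\{\alpha(1),\ldots,\alpha(i-1)\}$. $\widetilde{\mathrm{PF}}_n(\lambda)$ is the set of restricted $\lambda$-parking functions of length $n$. $s(n,r)$ is the number of permutations of $[n]$ with exactly $r$ cycles. *)

theory Defs
  imports
    "HOL-Library.Poly_Mapping"
    "HOL-Computational_Algebra.Polynomial"
    "HOL-Algebra.Embedded_Algebras"
    "HOL-Algebra.QuotRing"
    "HOL-Combinatorics.Orbits"
    "HOL-Analysis.Gamma_Function"
begin

section \<open>The polynomial ring in the variables \<open>x\<^sub>1, \<dots>, x\<^sub>n\<close>\<close>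

text \<open>A polynomial is a finitely supported map from exponent vectors to coefficients. The type
  has a variable for every natural number; \<open>mpoly_ring n\<close> keeps those polynomials in which
  only the variables with index in \<open>{1..n}\<close> occur.\<close>

type_synonym 'k mpoly = "(nat \<Rightarrow>\<^sub>0 nat) \<Rightarrow>\<^sub>0 'k"

definition mpoly_ring :: "nat \<Rightarrow> 'k::field mpoly ring" where
  "mpoly_ring n =
     \<lparr>carrier = {p. \<forall>m\<in>Poly_Mapping.keys p. Poly_Mapping.keys m \<subseteq> {1..n}},
      monoid.mult = (*), one = 1, zero = 0, add = (+)\<rparr>"

definition pconst :: "'k::field \<Rightarrow> 'k mpoly" where
  "pconst a = Poly_Mapping.single 0 a"

definition xmonom :: "(nat \<Rightarrow>\<^sub>0 nat) \<Rightarrow> 'k::field mpoly" where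
  "xmonom m = Poly_Mapping.single m 1"

definition xvar :: "nat \<Rightarrow> 'k::field mpoly" where
  "xvar i = xmonom (Poly_Mapping.single i 1)"

lemma cring_mpoly_ring: "cring (mpoly_ring n :: 'k::field mpoly ring)"
proof (rule cringI)
  let ?R = "mpoly_ring n :: 'k mpoly ring"
  show "abelian_group ?R"
  proof (rule abelian_groupI)
    fix x y assume "x \<in> carrier ?R" "y \<in> carrier ?R"
    then show "x \<oplus>\<^bsub>?R\<^esub> y \<in> carrier ?R"
      using Poly_Mapping.keys_add[of x y] by (auto simp: mpoly_ring_def dest!: subsetD)
  next
    fix x assume "x \<in> carrier ?R"
    then show "\<exists>y\<in>carrier ?R. y \<oplus>\<^bsub>?R\<^esub> x = \<zero>\<^bsub>?R\<^esub>"
      by (intro bexI[of _ "- x"]) (auto simp: mpoly_ring_def)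
  qed (auto simp: mpoly_ring_def add_ac)
  show "Group.comm_monoid ?R"
  proof (rule comm_monoidI)
    fix x y assume xy: "x \<in> carrier ?R" "y \<in> carrier ?R"
    have "Poly_Mapping.keys m \<subseteq> {1..n}" if "m \<in> Poly_Mapping.keys (x * y)" for m
    proof -
      obtain a d where "m = a + d" "a \<in> Poly_Mapping.keys x" "d \<in> Poly_Mapping.keys y"
        using \<open>m \<in> Poly_Mapping.keys (x * y)\<close> Poly_Mapping.keys_mult[of x y] by blast
      then show ?thesis
        using xy Poly_Mapping.keys_add[of a d] by (fastforce simp: mpoly_ring_def)
    qed
    then show "x \<otimes>\<^bsub>?R\<^esub> y \<in> carrier ?R"
      by (simp add: mpoly_ring_def)
  qed (auto simp: mpoly_ring_def mult_ac)
qed (auto simp: mpoly_ring_def distrib_right)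

text \<open>The field of constants, viewed inside \<open>R/J\<close>; it is isomorphic to \<open>'k\<close> for a proper
  ideal \<open>J\<close>.\<close>

definition quot_scalars :: "nat \<Rightarrow> 'k::field mpoly set \<Rightarrow> 'k mpoly set set" where
  "quot_scalars n J = range (\<lambda>a. J +>\<^bsub>mpoly_ring n\<^esub> pconst a)"

definition finite_dim_quot :: "nat \<Rightarrow> 'k::field mpoly set \<Rightarrow> bool" where
  "finite_dim_quot n J \<longleftrightarrow>
     ring.finite_dimension (mpoly_ring n Quot J) (quot_scalars n J) (carrier (mpoly_ring n Quot J))"

definition dim_quot :: "nat \<Rightarrow> 'k::field mpoly set \<Rightarrow> nat" where
  "dim_quot n J =
     ring.dim (mpoly_ring n Quot J) (quot_scalars n J) (carrier (mpoly_ring n Quot J))"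


section \<open>Monomial ideals and Alexander duals\<close>

text \<open>Exponent vectors of the minimal generators of a monomial ideal: the monomials of \<open>I\<close>
  that are minimal for divisibility.\<close>

definition min_gens :: "nat \<Rightarrow> 'k::field mpoly set \<Rightarrow> (nat \<Rightarrow>\<^sub>0 nat) set" where
  "min_gens n I =
     {m. Poly_Mapping.keys m \<subseteq> {1..n} \<and> xmonom m \<in> I \<and>
         (\<forall>d. xmonom d \<in> I \<and> (\<forall>i. Poly_Mapping.lookup d i \<le> Poly_Mapping.lookup m i) \<longrightarrow> d = m)}"

definition irr_ideal :: "nat \<Rightarrow> (nat \<Rightarrow> nat) \<Rightarrow> 'k::field mpoly set" where
  "irr_ideal n d = Idl\<^bsub>mpoly_ring n\<^esub> {xvar i ^ d i | i. i \<in> {1..n} \<and> d i \<ge> 1}"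

definition dual_exp :: "(nat \<Rightarrow> nat) \<Rightarrow> (nat \<Rightarrow>\<^sub>0 nat) \<Rightarrow> nat \<Rightarrow> nat" where
  "dual_exp a m i = (if Poly_Mapping.lookup m i \<ge> 1 then a i + 1 - Poly_Mapping.lookup m i else 0)"

text \<open>Meaningful when the minimal generators of \<open>I\<close> divide \<open>x\<^sup>a\<close>, so that the
  subtraction in \<open>dual_exp\<close> is not truncated. The intersection with the carrier only matters
  for \<open>I = 0\<close>.\<close>

definition alexander_dual :: "nat \<Rightarrow> (nat \<Rightarrow> nat) \<Rightarrow> 'k::field mpoly set \<Rightarrow> 'k mpoly set" where
  "alexander_dual n a I =
     carrier (mpoly_ring n) \<inter> (\<Inter>m\<in>min_gens n I. irr_ideal n (dual_exp a m))"


text \<open>\<open>ring.dim\<close> and \<open>ring.finite_dimension\<close> are only determined when their ring argument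
  is a ring; this is the case for the quotient by an Alexander dual.\<close>

lemma xvar_power_carrier:
  assumes "i \<in> {1..n}"
  shows "(xvar i :: 'k::field mpoly) ^ d \<in> carrier (mpoly_ring n)"
proof (induction d)
  case 0
  then show ?case by (simp add: mpoly_ring_def)
next
  case (Suc d)
  interpret cring "mpoly_ring n :: 'k mpoly ring" by (rule cring_mpoly_ring)
  have "(xvar i :: 'k mpoly) \<in> carrier (mpoly_ring n)"
    using assms by (simp add: mpoly_ring_def xvar_def xmonom_def)
  from m_closed[OF this Suc] show ?case
    by (simp add: mpoly_ring_def)
qed

lemma ideal_irr_ideal: "ideal (irr_ideal n d :: 'k::field mpoly set) (mpoly_ring n)"
proof -
  interpret cring "mpoly_ring n :: 'k mpoly ring" by (rule cring_mpoly_ring)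
  show ?thesis
    unfolding irr_ideal_def by (rule genideal_ideal) (use xvar_power_carrier in blast)
qed

lemma ideal_alexander_dual:
  "ideal (alexander_dual n a I :: 'k::field mpoly set) (mpoly_ring n)"
proof -
  interpret cring "mpoly_ring n :: 'k mpoly ring" by (rule cring_mpoly_ring)
  let ?S = "insert (carrier (mpoly_ring n)) ((\<lambda>m. irr_ideal n (dual_exp a m)) ` min_gens n I)"
  have "ideal (\<Inter>?S) (mpoly_ring n :: 'k mpoly ring)"
    by (rule i_Intersect) (auto simp: ideal_irr_ideal oneideal)
  then show ?thesis
    by (simp add: alexander_dual_def)
qed

lemma ring_quot_alexander_dual:
  "ring (mpoly_ring n Quot (alexander_dual n a I :: 'k::field mpoly set))"
  by (rule ideal.quotient_is_ring[OF ideal_alexander_dual])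


section \<open>Pattern avoidance\<close>

text \<open>Patterns are given in one-line notation; \<open>f\<close> selects the positions of the subsequence.\<close>

definition contains_pattern :: "nat \<Rightarrow> (nat \<Rightarrow> nat) \<Rightarrow> nat list \<Rightarrow> bool" where
  "contains_pattern n \<sigma> \<tau> \<longleftrightarrow>
     (\<exists>f. strict_mono_on {..<length \<tau>} f \<and> f ` {..<length \<tau>} \<subseteq> {1..n} \<and>
          (\<forall>j<length \<tau>. \<forall>k<length \<tau>. \<sigma> (f j) < \<sigma> (f k) \<longleftrightarrow> \<tau> ! j < \<tau> ! k))"

definition avoiding_perms :: "nat \<Rightarrow> nat list set \<Rightarrow> (nat \<Rightarrow> nat) set" where
  "avoiding_perms n P = {\<sigma>. \<sigma> permutes {1..n} \<and> (\<forall>\<tau>\<in>P. \<not> contains_pattern n \<sigma> \<tau>)}"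

definition perm_ideal ::
    "nat \<Rightarrow> (nat \<Rightarrow> nat) set \<Rightarrow> (nat \<Rightarrow> nat) \<Rightarrow> 'k::field mpoly set" where
  "perm_ideal n W u = Idl\<^bsub>mpoly_ring n\<^esub> {\<Prod>i\<in>{1..n}. xvar i ^ u (\<sigma> i) | \<sigma>. \<sigma> \<in> W}"


section \<open>Parking functions\<close>

text \<open>Lists are indexed from 0, hence the shift in \<open>! (j - 1)\<close>.\<close>

definition parking_functions :: "nat \<Rightarrow> (nat \<Rightarrow> nat) \<Rightarrow> (nat \<Rightarrow> nat) set" where
  "parking_functions n lam =
     {p \<in> {1..n} \<rightarrow>\<^sub>E UNIV. \<forall>j\<in>{1..n}. sort (map p [1..<Suc n]) ! (j - 1) < lam (n - j + 1)}"

text \<open>The element \<open>j = j\<^sub>s\<close> of \<open>T = {j\<^sub>1 < \<dots> < j\<^sub>t}\<close> has rank \<open>s = card {i \<in> T. i \<le> j}\<close>.\<close>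

definition mu :: "nat \<Rightarrow> (nat \<Rightarrow> nat) \<Rightarrow> nat \<Rightarrow> nat \<Rightarrow> nat set \<Rightarrow> nat" where
  "mu n u c j T =
     (if j = Min T then u n - u (card T) + c
      else u n - u (card T + j - card {i\<in>T. i \<le> j}) + c)"

definition restricted_parking_functions ::
    "nat \<Rightarrow> (nat \<Rightarrow> nat) \<Rightarrow> nat \<Rightarrow> (nat \<Rightarrow> nat) \<Rightarrow> (nat \<Rightarrow> nat) set" where
  "restricted_parking_functions n u c lam =
     {p \<in> parking_functions n lam.
        \<exists>\<alpha>. \<alpha> permutes {1..n} \<and>
            (\<forall>i\<in>{1..n}. p (\<alpha> i) < mu n u c (\<alpha> i) ({1..n} - \<alpha> ` {1..<i}))}"


section \<open>Signless Stirling numbers of the first kind\<close>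

text \<open>Cycles are the orbits on \<open>{1..n}\<close>; fixed points count as cycles.\<close>

definition num_cycles :: "nat \<Rightarrow> (nat \<Rightarrow> nat) \<Rightarrow> nat" where
  "num_cycles n \<sigma> = card (orbit \<sigma> ` {1..n})"

definition stirling1 :: "nat \<Rightarrow> nat \<Rightarrow> nat" where
  "stirling1 n r = card {\<sigma>. \<sigma> permutes {1..n} \<and> num_cycles n \<sigma> = r}"

definition a_tilde_poly :: "nat \<Rightarrow> nat \<Rightarrow> real poly" where
  "a_tilde_poly n b =
     (\<Sum>r=1..n. Polynomial.smult (real (b ^ (n - r) * stirling1 n r)) (\<Prod>j<r. [:real (j * b), 1:]))"

end

theory Submission
  imports Defs "HOL-Combinatorics.Stirling"
begin

text \<open>The permutations avoiding 132 and 312 are those in which every entry is larger than all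
  earlier entries or smaller than all of them. Hence \<open>R/J\<close> has as a basis the monomials
  \<open>x\<^sup>p\<close> for which some set \<open>U\<close> of positions (those of the left-to-right maxima) satisfies
  \<open>p\<^sub>k < c + b |U \<inter> (k, n]|\<close> for \<open>k \<in> U\<close> and \<open>p\<^sub>k < c + b (k - 1 + |U \<inter> (k, n]|)\<close> for
  \<open>k \<notin> U\<close>. The restricted parking functions are the same vectors: given \<open>U\<close>, remove the
  elements of \<open>U\<close> in decreasing order and then the other ones in increasing order. If such a set
  exists, the one built greedily from \<open>n\<close> downwards, putting \<open>k\<close> into \<open>U\<close> whenever the first
  bound holds, also works. So each vector has a canonical \<open>U\<close>, and \<open>U\<close> is the
  canonical set of \<open>(\<Prod>k\<in>U. c + b |U \<inter> (k, n]|) (\<Prod>k\<notin>U. b (k - 1))\<close> vectors. Summing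
  over \<open>U\<close> gives the Stirling numbers.\<close>

section \<open>Stirling numbers of the first kind\<close>

text \<open>As \<open>\<pi>\<close> fixes \<open>a\<close>, the composition sends the
  \<open>\<pi>\<close>-preimage of \<open>b\<close> to \<open>a\<close> and \<open>a\<close> to
  \<open>b\<close>. In cycle notation \<open>a\<close> is inserted directly before \<open>b\<close>,
  and all other cycles stay as they are.\<close>

lemma orbit_transpose_comp:
  assumes "\<pi> permutes S" "a \<notin> S" "b \<in> S" "x \<in> S"
  shows "orbit (Transposition.transpose a b \<circ> \<pi>) x = orbit \<pi> x \<union> (if b \<in> orbit \<pi> x then {a} else {})"
    (is "orbit ?s x = ?R")
proof -
  have pa: "\<pi> a = a" using assms by (meson permutes_not_in)
  have sub: "orbit \<pi> x \<subseteq> S" using assms by (intro permutes_orbit_subset)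
  have in_S: "\<pi> y \<in> S" if "y \<in> S" for y using assms that by (simp add: permutes_in_image)
  have sa: "?s a = b" by (simp add: pa)
  have s_eq: "?s y = (if \<pi> y = b then a else \<pi> y)" if "y \<in> S" for y
    using in_S[OF that] assms by (auto simp: Transposition.transpose_def)
  have "z \<in> ?R" if "z \<in> orbit ?s x" for z
    using that
  proof induction
    case base
    then show ?case using s_eq[OF \<open>x \<in> S\<close>] orbit.base[of \<pi> x] by auto
  next
    case (step y)
    show ?case
    proof (cases "y = a")
      case True
      with step sub assms show ?thesis by (auto simp: sa simp del: o_apply split: if_splits)
    next
      case False
      then have y: "y \<in> orbit \<pi> x" using step by (auto split: if_splits)
      then have "?s y = (if \<pi> y = b then a else \<pi> y)" using s_eq sub by auto
      then show ?thesis using orbit.step[OF y] by auto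
    qed
  qed
  moreover have one_step: "\<pi> y \<in> orbit ?s x" if "?s y \<in> orbit ?s x" "y \<in> S" for y
    using that s_eq[of y] orbit.step[of a ?s x] sa by (auto simp del: o_apply split: if_splits)
  have "z \<in> orbit ?s x" if "z \<in> orbit \<pi> x" for z
    using that
  proof induction
    case base
    show ?case by (rule one_step[OF orbit.base \<open>x \<in> S\<close>])
  next
    case (step y)
    then show ?case using sub by (intro one_step orbit.step) auto
  qed
  moreover have "a \<in> orbit ?s x" if b: "b \<in> orbit \<pi> x"
    using b
  proof cases
    case base
    then show ?thesis using s_eq[OF \<open>x \<in> S\<close>] orbit.base[of ?s x] by simp
  next
    case (step y)
    then have "y \<in> orbit ?s x" "y \<in> S" using calculation sub by auto
    then show ?thesis using s_eq[of y] step orbit.step[of y ?s x] by simp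
  qed
  ultimately show ?thesis by (intro equalityI subsetI) (blast, auto split: if_splits)
qed

text \<open>The new element joins the cycle of \<open>b\<close>, so no cycle is created. Distinct
  orbits stay distinct because deleting \<open>a\<close> recovers the old orbit.\<close>

lemma card_orbits_transpose_comp:
  assumes "\<pi> permutes S" "finite S" "a \<notin> S" "b \<in> S"
  shows "card (orbit (Transposition.transpose a b \<circ> \<pi>) ` insert a S) = card (orbit \<pi> ` S)"
proof -
  let ?s = "Transposition.transpose a b \<circ> \<pi>"
  let ?g = "\<lambda>B. B \<union> (if b \<in> B then {a} else {})"
  have perm: "?s permutes insert a S"
    using assms by (intro permutes_compose permutes_swap_id) (auto intro: permutes_subset)
  have "\<pi> a = a" using assms by (meson permutes_not_in)
  then have "orbit ?s a = orbit ?s b"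
    using permutation_orbit_step[of ?s a] perm assms(2) by (auto simp: permutation_permutes)
  then have "orbit ?s ` insert a S = orbit ?s ` S"
    using assms(4) by (auto simp del: o_apply)
  also have "\<dots> = ?g ` (orbit \<pi> ` S)"
    unfolding image_image using assms by (intro image_cong orbit_transpose_comp refl) auto
  also have "card \<dots> = card (orbit \<pi> ` S)"
  proof (rule card_image, rule inj_onI)
    fix A B assume "A \<in> orbit \<pi> ` S" "B \<in> orbit \<pi> ` S" and eq: "?g A = ?g B"
    then have "a \<notin> A" "a \<notin> B"
      using assms permutes_orbit_subset[OF assms(1)] by blast+
    moreover have "?g C - {a} = C" if "a \<notin> C" for C using that by auto
    ultimately show "A = B" using eq by metis
  qed
  finally show ?thesis .
qed

lemma card_orbits_insert_fixed:
  assumes "\<pi> permutes S" "finite S" "a \<notin> S"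
  shows "card (orbit \<pi> ` insert a S) = Suc (card (orbit \<pi> ` S))"
proof -
  have "\<pi> a = a" using assms by (meson permutes_not_in)
  then have "orbit \<pi> a = {a}" by (simp add: orbit_eq_singleton_iff)
  moreover have "{a} \<notin> orbit \<pi> ` S"
    using assms permutes_orbit_subset[OF assms(1)] by blast
  ultimately show ?thesis using assms by simp
qed

text \<open>Every permutation of \<open>insert a S\<close> is the composition of the transposition
  of \<open>a\<close> and \<open>b\<close> with some \<open>\<pi>\<close> permuting
  \<open>S\<close>, where \<open>b\<close> is the image of \<open>a\<close> and hence unique. For
  \<open>b = a\<close> a fixed point is added as a new cycle; each of the \<open>card S\<close>
  other choices keeps the number of cycles.\<close>

lemma card_permutes_insert_Suc_orbits:
  assumes "finite S" "a \<notin> S"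
  shows "card {\<sigma>. \<sigma> permutes insert a S \<and> card (orbit \<sigma> ` insert a S) = Suc r} =
         card S * card {\<pi>. \<pi> permutes S \<and> card (orbit \<pi> ` S) = Suc r} +
         card {\<pi>. \<pi> permutes S \<and> card (orbit \<pi> ` S) = r}"
proof -
  define P where "P r = {\<pi>. \<pi> permutes S \<and> card (orbit \<pi> ` S) = r}" for r
  let ?f = "\<lambda>(b, \<pi>). Transposition.transpose a b \<circ> \<pi>"
  have fin: "finite (P r)" for r
    unfolding P_def by (rule finite_subset[OF _ finite_permutations[OF assms(1)]]) auto
  have a_fix: "\<pi> a = a" if "\<pi> permutes S" for \<pi>
    using that assms by (meson permutes_not_in)
  have inj: "inj_on ?f {(b, \<pi>). \<pi> permutes S}"
  proof (rule inj_onI, clarify)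
    fix b \<pi> b' \<pi>'
    assume *: "\<pi> permutes S" "\<pi>' permutes S" "Transposition.transpose a b \<circ> \<pi> = Transposition.transpose a b' \<circ> \<pi>'"
    from fun_cong[OF *(3), of a] have "b = b'" by (simp add: a_fix[OF *(1)] a_fix[OF *(2)])
    moreover from *(3) have "Transposition.transpose a b \<circ> (Transposition.transpose a b \<circ> \<pi>) = Transposition.transpose a b \<circ> (Transposition.transpose a b' \<circ> \<pi>')"
      by simp
    ultimately show "b = b' \<and> \<pi> = \<pi>'" by (simp flip: o_assoc) (simp add: o_assoc)
  qed
  have "{\<sigma>. \<sigma> permutes insert a S \<and> card (orbit \<sigma> ` insert a S) = Suc r} =
        ?f ` {(b, \<pi>). b \<in> insert a S \<and> \<pi> permutes S \<and>
                card (orbit (Transposition.transpose a b \<circ> \<pi>) ` insert a S) = Suc r}"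
    using permutes_insert[of a S] by (auto simp: set_eq_iff image_iff simp del: o_apply)
  also have "{(b, \<pi>). b \<in> insert a S \<and> \<pi> permutes S \<and>
                card (orbit (Transposition.transpose a b \<circ> \<pi>) ` insert a S) = Suc r} =
             S \<times> P (Suc r) \<union> {a} \<times> P r" (is "_ = ?D")
    using assms card_orbits_transpose_comp[OF _ assms] card_orbits_insert_fixed[OF _ assms]
    by (auto simp: P_def simp del: image_insert o_apply)
  also have "card (?f ` ?D) = card ?D"
    by (intro card_image inj_on_subset[OF inj]) (auto simp: P_def)
  also have "\<dots> = card S * card (P (Suc r)) + card (P r)"
    using assms fin by (subst card_Un_disjoint) (auto simp: card_cartesian_product)
  finally show ?thesis unfolding P_def .
qed

text \<open>The cycle count satisfies the recursion that defines \<open>stirling\<close>, so the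
  induction follows its four equations.\<close>

lemma stirling1_eq_stirling: "stirling1 n r = stirling n r"
proof (induction n r rule: stirling.induct)
  case 1
  have "{\<sigma> :: nat \<Rightarrow> nat. \<sigma> = id \<and> card (orbit \<sigma> ` {}) = 0} = {id}" by auto
  then show ?case by (simp add: stirling1_def num_cycles_def)
next
  case (2 k)
  then show ?case by (simp add: stirling1_def num_cycles_def)
next
  case (3 n)
  have "finite (orbit \<sigma> ` {1..Suc n})" "orbit \<sigma> ` {1..Suc n} \<noteq> {}" for \<sigma> by auto
  then have "num_cycles (Suc n) \<sigma> \<noteq> 0" for \<sigma>
    unfolding num_cycles_def by (metis card_eq_0_iff)
  then show ?case by (simp add: stirling1_def card_eq_0_iff)
next
  case (4 n k)
  have "{1..Suc n} = insert (Suc n) {1..n}" by auto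
  then show ?case
    using 4 card_permutes_insert_Suc_orbits[of "{1..n}" "Suc n" k]
    by (simp add: stirling1_def num_cycles_def del: image_insert)
qed

text \<open>In other words, \<open>stirling n r\<close> is the elementary symmetric polynomial of
  degree \<open>n - r\<close> in \<open>0, ..., n - 1\<close>. The weight \<open>F\<close> is
  arbitrary because the sets containing \<open>Suc n\<close> are handled by the induction hypothesis
  for the shifted weight \<open>F (Suc r)\<close>; those without it gain a factor
  \<open>n\<close>.\<close>

lemma sum_Pow_prod_compl_eq_stirling:
  fixes F :: "nat \<Rightarrow> nat"
  shows "(\<Sum>U\<in>Pow {1..n}. F (card U) * (\<Prod>k\<in>{1..n} - U. k - 1)) = (\<Sum>r\<le>n. stirling n r * F r)"
proof (induction n arbitrary: F)
  case 0
  then show ?case by simp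
next
  case (Suc n)
  let ?h = "\<lambda>U. F (card U) * (\<Prod>k\<in>{1..Suc n} - U. k - 1)"
  have "Pow {1..Suc n} = Pow {1..n} \<union> insert (Suc n) ` Pow {1..n}"
    by (simp flip: Pow_insert add: atLeastAtMostSuc_conv)
  then have "(\<Sum>U\<in>Pow {1..Suc n}. ?h U) =
      (\<Sum>U\<in>Pow {1..n}. ?h U) + (\<Sum>U\<in>insert (Suc n) ` Pow {1..n}. ?h U)"
    by (simp only:) (rule sum.union_disjoint, auto)
  also have "(\<Sum>U\<in>Pow {1..n}. ?h U) =
      (\<Sum>U\<in>Pow {1..n}. n * F (card U) * (\<Prod>k\<in>{1..n} - U. k - 1))"
  proof (intro sum.cong refl)
    fix U assume "U \<in> Pow {1..n}"
    then have "{1..Suc n} - U = insert (Suc n) ({1..n} - U)" by auto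
    then show "?h U = n * F (card U) * (\<Prod>k\<in>{1..n} - U. k - 1)" by simp
  qed
  also have "\<dots> = (\<Sum>r\<le>n. stirling n r * (n * F r))"
    by (rule Suc.IH)
  also have "(\<Sum>U\<in>insert (Suc n) ` Pow {1..n}. ?h U) =
      (\<Sum>U\<in>Pow {1..n}. F (Suc (card U)) * (\<Prod>k\<in>{1..n} - U. k - 1))"
  proof (subst sum.reindex)
    show "inj_on (insert (Suc n)) (Pow {1..n})"
      by (rule inj_onI) (metis PowD Suc_n_not_le_n atLeastAtMost_iff insert_ident subsetD)
    show "(\<Sum>U\<in>Pow {1..n}. (?h \<circ> insert (Suc n)) U) =
      (\<Sum>U\<in>Pow {1..n}. F (Suc (card U)) * (\<Prod>k\<in>{1..n} - U. k - 1))"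
    proof (intro sum.cong refl)
      fix U assume U: "U \<in> Pow {1..n}"
      then have "{1..Suc n} - insert (Suc n) U = {1..n} - U" by auto
      moreover have "card (insert (Suc n) U) = Suc (card U)"
        using U by (subst card_insert_disjoint) (auto intro: finite_subset)
      ultimately show "(?h \<circ> insert (Suc n)) U = F (Suc (card U)) * (\<Prod>k\<in>{1..n} - U. k - 1)"
        by simp
    qed
  qed
  also have "\<dots> = (\<Sum>r\<le>n. stirling n r * F (Suc r))"
    by (rule Suc.IH)
  \<comment> \<open>The shifted sum may run up to \<open>r = n\<close>, since
    \<open>stirling n (Suc n) = 0\<close>.\<close>
  also have "(\<Sum>r\<le>n. stirling n r * (n * F r)) =
      n * stirling n 0 * F 0 + (\<Sum>r\<le>n. n * stirling n (Suc r) * F (Suc r))"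
    by (subst sum.atMost_Suc[of "\<lambda>r. stirling n r * (n * F r)" n,
          simplified sum.atMost_Suc_shift, symmetric, simplified]) (simp add: mult_ac)
  also have "n * stirling n 0 = 0" by (cases n) auto
  finally show ?case
    by (simp add: sum.atMost_Suc_shift algebra_simps sum.distrib del: sum.atMost_Suc)
qed

section \<open>Admissible and greedy sets\<close>

text \<open>\<open>U\<close> plays the role of the set of left-to-right maxima of a permutation avoiding 132 and 312,
  or of the elements that are removed first, in decreasing order, in the definition of restricted
  parking functions.\<close>

definition admissible :: "nat \<Rightarrow> nat \<Rightarrow> nat \<Rightarrow> nat set \<Rightarrow> (nat \<Rightarrow> nat) \<Rightarrow> bool" where
  "admissible n b c U p \<longleftrightarrow> U \<subseteq> {1..n} \<and>
     (\<forall>k\<in>{1..n}. p k < c + b * ((if k \<in> U then 0 else k - 1) + card (U \<inter> {k<..})))"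

text \<open>The condition at \<open>k\<close> refers only to the members of \<open>U\<close> above
  \<open>k\<close>, so it is a recursion from \<open>n\<close> downwards that determines
  \<open>U\<close> completely.\<close>

definition greedy :: "nat \<Rightarrow> nat \<Rightarrow> nat \<Rightarrow> nat set \<Rightarrow> (nat \<Rightarrow> nat) \<Rightarrow> bool" where
  "greedy n b c U p \<longleftrightarrow> U \<subseteq> {1..n} \<and>
     (\<forall>k\<in>{1..n}. k \<in> U \<longleftrightarrow> p k < c + b * card (U \<inter> {k<..}))"

lemma greedy_exists: "\<exists>U. greedy n b c U p"
proof -
  have "\<exists>U\<subseteq>{j<..n}. \<forall>k\<in>{j<..n}. k \<in> U \<longleftrightarrow> p k < c + b * card (U \<inter> {k<..})" if "j \<le> n" for j
    using that
  proof (induction rule: inc_induct)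
    case base
    then show ?case by auto
  next
    case (step j)
    then obtain U where U: "U \<subseteq> {Suc j<..n}"
        "\<And>k. k \<in> {Suc j<..n} \<Longrightarrow> k \<in> U \<longleftrightarrow> p k < c + b * card (U \<inter> {k<..})" by blast
    define V where "V = (if p (Suc j) < c + b * card U then insert (Suc j) U else U)"
    have "V \<inter> {k<..} = U \<inter> {k<..}" if "k > j" for k using that by (auto simp: V_def)
    moreover have "U \<inter> {Suc j<..} = U" using U(1) by auto
    moreover have "{j<..n} = insert (Suc j) {Suc j<..n}" using step by auto
    ultimately have "\<forall>k\<in>{j<..n}. k \<in> V \<longleftrightarrow> p k < c + b * card (V \<inter> {k<..})"
      using U by (auto simp: V_def)
    moreover have "V \<subseteq> {j<..n}" using U(1) step by (auto simp: V_def)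
    ultimately show ?case by blast
  qed
  moreover have "{0<..n} = {1..n}" by auto
  ultimately show ?thesis unfolding greedy_def by (metis le0)
qed

lemma greedy_unique:
  assumes "greedy n b c U p" "greedy n b c V p"
  shows "U = V"
proof -
  have "U \<inter> {j<..} = V \<inter> {j<..}" if "j \<le> n" for j
    using that
  proof (induction rule: inc_induct)
    case base
    then show ?case using assms by (auto simp: greedy_def)
  next
    case (step j)
    have "Suc j \<in> U \<longleftrightarrow> Suc j \<in> V"
      using assms step by (simp add: greedy_def)
    moreover have "W \<inter> {j<..} = (W \<inter> {Suc j<..}) \<union> (W \<inter> {Suc j})" for W by auto
    ultimately show ?case using step.IH by auto
  qed
  from this[of 0] have "U \<inter> {0<..} = V \<inter> {0<..}" by simp
  moreover have "U \<inter> {0<..} = U" "V \<inter> {0<..} = V" using assms by (auto simp: greedy_def)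
  ultimately show ?thesis by simp
qed

text \<open>Moving an element into the set only raises the bounds of the smaller ones, so the
  greedy choice is optimal.\<close>

lemma admissible_greedy:
  assumes V: "admissible n b c V p" and U: "greedy n b c U p"
  shows "admissible n b c U p"
proof -
  have fin: "finite U" "finite V"
    using assms finite_subset by (auto simp: greedy_def admissible_def)
  \<comment> \<open>Downward induction: an element of \<open>V\<close> satisfies its bound with
    respect to \<open>V\<close>, hence the weaker one with respect to \<open>U\<close>, so the
    greedy choice takes it too.\<close>
  have le: "card (V \<inter> {j<..}) \<le> card (U \<inter> {j<..})" if "j \<le> n" for j
    using that
  proof (induction rule: inc_induct)
    case base
    have "V \<inter> {n<..} = {}" using V by (auto simp: admissible_def)
    then show ?case by simp
  next
    case (step j)
    have *: "card (W \<inter> {j<..}) = card (W \<inter> {Suc j<..}) + (if Suc j \<in> W then 1 else 0)"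
      if "finite W" for W
    proof -
      have "W \<inter> {j<..} = (if Suc j \<in> W then insert (Suc j) (W \<inter> {Suc j<..}) else W \<inter> {Suc j<..})"
        by (auto intro: Suc_lessI split: if_splits)
      then show ?thesis using that by auto
    qed
    have "Suc j \<in> U" if "Suc j \<in> V"
    proof -
      have "p (Suc j) < c + b * card (V \<inter> {Suc j<..})"
        using V that step by (auto simp: admissible_def dest!: bspec[of _ _ "Suc j"])
      also have "\<dots> \<le> c + b * card (U \<inter> {Suc j<..})" using step.IH by simp
      finally show ?thesis using U step by (auto simp: greedy_def)
    qed
    then show ?case using step.IH *[OF fin(1)] *[OF fin(2)] by auto
  qed
  have "p k < c + b * ((if k \<in> U then 0 else k - 1) + card (U \<inter> {k<..}))" if k: "k \<in> {1..n}" for k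
  proof (cases "k \<in> U")
    case True
    then show ?thesis using U k by (auto simp: greedy_def)
  next
    case False
    have "p k < c + b * ((if k \<in> V then 0 else k - 1) + card (V \<inter> {k<..}))"
      using V k by (auto simp: admissible_def)
    also have "\<dots> \<le> c + b * (k - 1 + card (U \<inter> {k<..}))"
      using le[of k] k by (intro add_left_mono mult_left_mono add_mono) auto
    finally show ?thesis using False by simp
  qed
  then show ?thesis using U by (auto simp: admissible_def greedy_def)
qed

section \<open>Counting the vectors that have an admissible set\<close>

text \<open>Listed in decreasing order, the elements of \<open>U\<close> have 0, 1, 2, ... elements
  of \<open>U\<close> above them. The induction adds a new minimum, which has all of
  \<open>A\<close> above it.\<close>

lemma prod_card_above:
  fixes f :: "nat \<Rightarrow> nat" and U :: "nat set"
  assumes "finite U"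
  shows "(\<Prod>k\<in>U. f (card (U \<inter> {k<..}))) = (\<Prod>j<card U. f j)"
  using assms
proof (induction rule: finite_linorder_min_induct)
  case empty
  then show ?case by simp
next
  case (insert a A)
  have "insert a A \<inter> {a<..} = A" using insert by auto
  moreover have "insert a A \<inter> {k<..} = A \<inter> {k<..}" if "k \<in> A" for k using insert that by auto
  moreover have "a \<notin> A" using insert by auto
  ultimately show ?case using insert by simp
qed

lemma card_admissible:
  "card {p \<in> {1..n} \<rightarrow>\<^sub>E UNIV. \<exists>U. admissible n b c U p} =
   (\<Sum>r\<le>n. stirling n r * (b ^ (n - r) * (\<Prod>j<r. c + b * j)))"
proof -
  \<comment> \<open>The box of the admissible vectors whose greedy set is \<open>U\<close>: entries
    in \<open>U\<close> stay below the first bound, the others lie between the two bounds, an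
    interval of length \<open>b * (k - 1)\<close>.\<close>
  define B where "B U = PiE {1..n} (\<lambda>k. if k \<in> U then {..<c + b * card (U \<inter> {k<..})}
      else {c + b * card (U \<inter> {k<..})..<c + b * (k - 1 + card (U \<inter> {k<..}))})" for U
  have B_iff: "p \<in> B U \<longleftrightarrow> p \<in> {1..n} \<rightarrow>\<^sub>E UNIV \<and> greedy n b c U p \<and> admissible n b c U p"
    if "U \<subseteq> {1..n}" for U p
    using that unfolding B_def PiE_iff greedy_def admissible_def
    by (auto simp: Ball_def not_less split: if_splits)
  \<comment> \<open>The boxes cover the set because the greedy set of a vector is admissible as soon
    as any set is; they are disjoint because the greedy set is unique.\<close>
  have "{p \<in> {1..n} \<rightarrow>\<^sub>E UNIV. \<exists>U. admissible n b c U p} = (\<Union>U\<in>Pow {1..n}. B U)"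
  proof (rule Set.set_eqI)
    fix p
    have "greedy n b c U p \<Longrightarrow> U \<subseteq> {1..n}" for U by (simp add: greedy_def)
    then show "p \<in> {p \<in> {1..n} \<rightarrow>\<^sub>E UNIV. \<exists>U. admissible n b c U p} \<longleftrightarrow> p \<in> (\<Union>U\<in>Pow {1..n}. B U)"
      using B_iff greedy_exists[of n b c p] admissible_greedy[of n b c _ p] by fastforce
  qed
  also have "card \<dots> = (\<Sum>U\<in>Pow {1..n}. card (B U))"
  proof (rule card_UN_disjoint)
    show "\<forall>U\<in>Pow {1..n}. finite (B U)" by (auto simp: B_def intro!: finite_PiE)
    show "\<forall>U\<in>Pow {1..n}. \<forall>V\<in>Pow {1..n}. U \<noteq> V \<longrightarrow> B U \<inter> B V = {}"
      using B_iff greedy_unique[of n b c] by (metis PowD disjoint_iff)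
  qed auto
  also have "\<dots> = (\<Sum>U\<in>Pow {1..n}.
      (b ^ (n - card U) * (\<Prod>j<card U. c + b * j)) * (\<Prod>k\<in>{1..n} - U. k - 1))"
  proof (rule sum.cong[OF refl])
    fix U assume U: "U \<in> Pow {1..n}"
    then have fin: "finite U" by (auto intro: finite_subset)
    have "card (B U) = (\<Prod>k\<in>{1..n}. if k \<in> U then c + b * card (U \<inter> {k<..}) else b * (k - 1))"
      unfolding B_def by (subst card_PiE) (auto intro!: prod.cong simp: algebra_simps)
    also have "\<dots> = (\<Prod>k\<in>U. c + b * card (U \<inter> {k<..})) * (\<Prod>k\<in>{1..n} - U. b * (k - 1))"
      using U by (subst prod.If_cases)
        (auto intro!: arg_cong2[where f = "(*)"] prod.cong)
    also have "(\<Prod>k\<in>U. c + b * card (U \<inter> {k<..})) = (\<Prod>j<card U. c + b * j)"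
      by (rule prod_card_above[OF fin])
    also have "(\<Prod>k\<in>{1..n} - U. b * (k - 1)) = b ^ (n - card U) * (\<Prod>k\<in>{1..n} - U. k - 1)"
      using U fin by (simp add: prod.distrib card_Diff_subset)
    finally show "card (B U) =
        (b ^ (n - card U) * (\<Prod>j<card U. c + b * j)) * (\<Prod>k\<in>{1..n} - U. k - 1)"
      by (simp add: mult_ac)
  qed
  also have "\<dots> = (\<Sum>r\<le>n. stirling n r * (b ^ (n - r) * (\<Prod>j<r. c + b * j)))"
    by (rule sum_Pow_prod_compl_eq_stirling[where F = "\<lambda>r. b ^ (n - r) * (\<Prod>j<r. c + b * j)"])
  finally show ?thesis .
qed

section \<open>Permutations avoiding 132 and 312\<close>

text \<open>Both patterns end in their middle value. An occurrence of one of them is thus an entry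
  preceded by a smaller and a larger one; the order of these two decides which pattern it
  is.\<close>

lemma avoiding_perms_132_312_iff:
  "\<sigma> \<in> avoiding_perms n {[1, 3, 2], [3, 1, 2]} \<longleftrightarrow> \<sigma> permutes {1..n} \<and>
     (\<forall>k\<in>{1..n}. (\<forall>i\<in>{1..<k}. \<sigma> i < \<sigma> k) \<or> (\<forall>i\<in>{1..<k}. \<sigma> k < \<sigma> i))"
    (is "?L \<longleftrightarrow> ?R")
proof
  have ex3: "(\<forall>j<3. \<forall>k<3. P j k) \<longleftrightarrow> P 0 0 \<and> P 0 1 \<and> P 0 2 \<and> P 1 0 \<and> P 1 1 \<and> P 1 2 \<and> P 2 0 \<and> P 2 1 \<and> P 2 2"
    for P :: "nat \<Rightarrow> nat \<Rightarrow> bool"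
    by (auto simp: less_Suc_eq numeral_3_eq_3 numeral_2_eq_2)
  have pattern: "contains_pattern n \<sigma> [x, y, z] \<longleftrightarrow>
      (\<exists>i j k. 1 \<le> i \<and> i < j \<and> j < k \<and> k \<le> n \<and>
        (\<sigma> i < \<sigma> j \<longleftrightarrow> x < y) \<and> (\<sigma> i < \<sigma> k \<longleftrightarrow> x < z) \<and> (\<sigma> j < \<sigma> i \<longleftrightarrow> y < x) \<and>
        (\<sigma> j < \<sigma> k \<longleftrightarrow> y < z) \<and> (\<sigma> k < \<sigma> i \<longleftrightarrow> z < x) \<and> (\<sigma> k < \<sigma> j \<longleftrightarrow> z < y))"
    (is "_ \<longleftrightarrow> (\<exists>i j k. ?Q i j k)") for x y z
  proof
    assume "contains_pattern n \<sigma> [x, y, z]"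
    then obtain f where f: "strict_mono_on {..<3::nat} f" "f ` {..<3} \<subseteq> {1..n}"
      "\<forall>j<3. \<forall>k<3. \<sigma> (f j) < \<sigma> (f k) \<longleftrightarrow> [x, y, z] ! j < [x, y, z] ! k"
      by (auto simp: contains_pattern_def eval_nat_numeral)
    have "f 0 < f 1" "f 1 < f 2" using f(1) by (auto simp: strict_mono_on_def)
    moreover have "1 \<le> f 0" "f 2 \<le> n" using f(2) by (auto simp: image_subset_iff)
    ultimately show "\<exists>i j k. ?Q i j k"
      using f(3)[rule_format, of 0 1] f(3)[rule_format, of 0 2] f(3)[rule_format, of 1 0]
        f(3)[rule_format, of 1 2] f(3)[rule_format, of 2 0] f(3)[rule_format, of 2 1]
      by (intro exI[of _ "f 0"] exI[of _ "f 1"] exI[of _ "f 2"]) simp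
  next
    assume "\<exists>i j k. ?Q i j k"
    then obtain i j k where Q: "?Q i j k" by blast
    have "strict_mono_on {..<3} (\<lambda>m. [i, j, k] ! m)" "(\<lambda>m. [i, j, k] ! m) ` {..<3} \<subseteq> {1..n}"
      using Q by (auto simp: strict_mono_on_def less_Suc_eq numeral_3_eq_3)
    with Q show "contains_pattern n \<sigma> [x, y, z]"
      unfolding contains_pattern_def
      by (intro exI[of _ "\<lambda>m. [i, j, k] ! m"]) (simp add: ex3 flip: numeral_3_eq_3)
  qed
  {
    assume L: ?L
    then have perm: "\<sigma> permutes {1..n}" by (simp add: avoiding_perms_def)
    have "(\<forall>i\<in>{1..<k}. \<sigma> i < \<sigma> k) \<or> (\<forall>i\<in>{1..<k}. \<sigma> k < \<sigma> i)" if k: "k \<in> {1..n}" for k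
    proof (rule ccontr)
      assume "\<not> ?thesis"
      then obtain i j where ij: "i \<in> {1..<k}" "j \<in> {1..<k}" "\<not> \<sigma> i < \<sigma> k" "\<not> \<sigma> k < \<sigma> j" by blast
      have "\<sigma> i \<noteq> \<sigma> k" "\<sigma> j \<noteq> \<sigma> k" using permutes_inj[OF perm] ij by (auto dest: injD)
      with ij have *: "\<sigma> j < \<sigma> k" "\<sigma> k < \<sigma> i" by auto
      then consider "i < j" | "j < i" by (metis less_asym linorder_neqE_nat)
      then show False
      proof cases
        case 1
        have "contains_pattern n \<sigma> [3, 1, 2]"
          unfolding pattern using 1 ij * k by (intro exI[of _ i] exI[of _ j] exI[of _ k]) auto
        with L show False by (auto simp: avoiding_perms_def)
      next
        case 2
        have "contains_pattern n \<sigma> [1, 3, 2]"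
          unfolding pattern using 2 ij * k by (intro exI[of _ j] exI[of _ i] exI[of _ k]) auto
        with L show False by (auto simp: avoiding_perms_def)
      qed
    qed
    with perm show ?R by blast
  next
    assume R: ?R
    have False if "i < j" "j < k" "1 \<le> i" "k \<le> n"
        "\<sigma> i < \<sigma> k \<and> \<sigma> k < \<sigma> j \<or> \<sigma> j < \<sigma> k \<and> \<sigma> k < \<sigma> i" for i j k
    proof -
      have "k \<in> {1..n}" "i \<in> {1..<k}" "j \<in> {1..<k}" using that by auto
      then have "\<sigma> i < \<sigma> k \<and> \<sigma> j < \<sigma> k \<or> \<sigma> k < \<sigma> i \<and> \<sigma> k < \<sigma> j" using R by blast
      then show False using that by auto
    qed
    then have "\<not> contains_pattern n \<sigma> [1, 3, 2]" "\<not> contains_pattern n \<sigma> [3, 1, 2]"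
      unfolding pattern by fastforce+
    with R show ?L by (simp add: avoiding_perms_def)
  }
qed

lemma permutes_restrict:
  assumes "finite S" "inj_on f S" "f ` S \<subseteq> S"
  shows "(\<lambda>x. if x \<in> S then f x else x) permutes S"
proof (rule bij_imp_permutes)
  have "inj_on (\<lambda>x. if x \<in> S then f x else x) S" using assms(2) by (auto simp: inj_on_def)
  moreover have "(\<lambda>x. if x \<in> S then f x else x) ` S \<subseteq> S" using assms(3) by auto
  ultimately show "bij_betw (\<lambda>x. if x \<in> S then f x else x) S S"
    using endo_inj_surj[OF assms(1), of "\<lambda>x. if x \<in> S then f x else x"] by (simp add: bij_betw_def)
qed auto

text \<open>Assign values from position \<open>n\<close> down to 1: a position in \<open>U\<close>
  takes the largest remaining value, any other position the smallest. For this permutation the bound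
  \<open>c + b * (n - \<sigma> k)\<close> is exactly the bound in \<open>admissible\<close>.\<close>

lemma admissible_imp_avoiding_perm:
  assumes "admissible n b c U p"
  shows "\<exists>\<sigma>\<in>avoiding_perms n {[1, 3, 2], [3, 1, 2]}. \<forall>k\<in>{1..n}. p k < c + b * (n - \<sigma> k)"
proof -
  have U: "U \<subseteq> {1..n}" and fin: "finite U"
    using assms by (auto simp: admissible_def intro: finite_subset)
  define D where "D = {1..n} - U"
  have finD: "finite D" by (simp add: D_def)
  define f where "f k = (if k \<in> U then n - card (U \<inter> {k<..}) else Suc (card (D \<inter> {k<..})))" for k
  have split: "card (U \<inter> {k<..}) + card (D \<inter> {k<..}) = n - k" for k
  proof -
    have "U \<inter> {k<..} \<union> D \<inter> {k<..} = {k<..n}" using U by (auto simp: D_def)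
    then show ?thesis
      using fin finD by (subst card_Un_disjoint[symmetric]) (auto simp: D_def)
  qed
  have less: "card (W \<inter> {k<..}) < card (W \<inter> {i<..})" if "finite W" "k \<in> W" "i < k" for W :: "nat set" and i k
    using that by (intro psubset_card_mono) auto
  have le: "card (W \<inter> {k<..}) \<le> card (W \<inter> {i<..})" if "finite W" "i \<le> k" for W :: "nat set" and i k
    using that by (intro card_mono) auto
  have range: "f k \<in> {1..n}" if "k \<in> {1..n}" for k
    using that split[of k] by (auto simp: f_def)
  have mono: "if k \<in> U then f i < f k else f k < f i" if "1 \<le> i" "i < k" "k \<le> n" for i k
  proof (cases "k \<in> U")
    case True
    note * = less[OF fin True \<open>i < k\<close>] split[of i] split[of k] le[OF finD less_imp_le[OF \<open>i < k\<close>]]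
    from that True * show ?thesis by (simp add: f_def) linarith
  next
    case False
    then have "k \<in> D" using that by (auto simp: D_def)
    note * = less[OF finD \<open>k \<in> D\<close> \<open>i < k\<close>] split[of i] split[of k] le[OF fin less_imp_le[OF \<open>i < k\<close>]]
    from that False * show ?thesis by (simp add: f_def) linarith
  qed
  have "inj_on f {1..n}"
    by (rule linorder_inj_onI) (use mono in \<open>fastforce split: if_splits\<close>)+
  then have "(\<lambda>k. if k \<in> {1..n} then f k else k) \<in> avoiding_perms n {[1, 3, 2], [3, 1, 2]}"
    unfolding avoiding_perms_132_312_iff
  proof (intro conjI permutes_restrict ballI)
    fix k assume "k \<in> {1..n}"
    then show "(\<forall>i\<in>{1..<k}. (if i \<in> {1..n} then f i else i) < (if k \<in> {1..n} then f k else k)) \<or>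
        (\<forall>i\<in>{1..<k}. (if k \<in> {1..n} then f k else k) < (if i \<in> {1..n} then f i else i))"
      using mono[of _ k] by (cases "k \<in> U") auto
  qed (use range in auto)
  moreover have "p k < c + b * (n - f k)" if "k \<in> {1..n}" for k
  proof -
    have "n - f k = (if k \<in> U then 0 else k - 1) + card (U \<inter> {k<..})"
      using that split[of k] by (auto simp: f_def)
    then show ?thesis using assms that by (auto simp: admissible_def)
  qed
  ultimately show ?thesis by (intro bexI) auto
qed

text \<open>There are \<open>n - \<sigma> k\<close> positions with a value above
  \<open>\<sigma> k\<close>. Those after \<open>k\<close> are left-to-right maxima, since otherwise
  their value would be below \<open>\<sigma> k\<close>; those before \<open>k\<close> number at most
  \<open>k - 1\<close>, and there are none if \<open>k\<close> is itself a left-to-right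
  maximum.\<close>

lemma avoiding_perm_imp_admissible:
  assumes "\<sigma> \<in> avoiding_perms n {[1, 3, 2], [3, 1, 2]}" "\<forall>k\<in>{1..n}. p k < c + b * (n - \<sigma> k)"
  shows "admissible n b c {k \<in> {1..n}. \<forall>i\<in>{1..<k}. \<sigma> i < \<sigma> k} p"
proof -
  define U where "U = {k \<in> {1..n}. \<forall>i\<in>{1..<k}. \<sigma> i < \<sigma> k}"
  have perm: "\<sigma> permutes {1..n}"
    and avoid: "\<And>k. k \<in> {1..n} \<Longrightarrow> k \<notin> U \<Longrightarrow> \<forall>i\<in>{1..<k}. \<sigma> k < \<sigma> i"
    using assms(1) unfolding avoiding_perms_132_312_iff U_def by auto
  have "p k < c + b * ((if k \<in> U then 0 else k - 1) + card (U \<inter> {k<..}))" if k: "k \<in> {1..n}" for k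
  proof -
    let ?G = "{i \<in> {1..n}. \<sigma> k < \<sigma> i}"
    let ?B = "if k \<in> U then {} else {1..<k}"
    have "?G \<subseteq> ?B \<union> U \<inter> {k<..}"
    proof
      fix i assume i: "i \<in> ?G"
      then have "i \<noteq> k" by auto
      then consider "i < k" | "k < i" by linarith
      then show "i \<in> ?B \<union> U \<inter> {k<..}"
      proof cases
        case 1
        then show ?thesis using i k by (auto simp: U_def) (metis atLeastLessThan_iff less_asym One_nat_def)
      next
        case 2
        have "i \<in> U"
        proof (rule ccontr)
          assume "i \<notin> U"
          then have "\<sigma> i < \<sigma> k" using avoid[of i] i k 2 by auto
          with i show False by simp
        qed
        then show ?thesis using 2 by simp
      qed
    qed
    then have "card ?G \<le> card (?B \<union> U \<inter> {k<..})"
      by (rule card_mono[rotated]) (simp add: U_def)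
    moreover have "\<sigma> ` ?G = {\<sigma> k<..n}"
    proof -
      have "\<sigma> ` ?G = \<sigma> ` {1..n} \<inter> {\<sigma> k<..}" by auto
      also have "\<dots> = {1..n} \<inter> {\<sigma> k<..}" by (simp only: permutes_image[OF perm])
      finally show ?thesis by auto
    qed
    then have "card ?G = n - \<sigma> k"
      using card_image[OF inj_on_subset[OF permutes_inj[OF perm] subset_UNIV], of ?G] by simp
    ultimately have "n - \<sigma> k \<le> card (?B \<union> U \<inter> {k<..})" by simp
    also have "\<dots> \<le> card ?B + card (U \<inter> {k<..})" by (rule card_Un_le)
    also have "card ?B = (if k \<in> U then 0 else k - 1)" by simp
    finally have "c + b * (n - \<sigma> k) \<le> c + b * ((if k \<in> U then 0 else k - 1) + card (U \<inter> {k<..}))"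
      by simp
    with assms(2) k show ?thesis by (meson less_le_trans)
  qed
  moreover have "U \<subseteq> {1..n}" by (auto simp: U_def)
  ultimately show ?thesis unfolding U_def[symmetric] by (simp add: admissible_def)
qed

section \<open>Restricted parking functions\<close>

text \<open>The inverse of the rank function \<open>\<rho>\<close> lists the elements by increasing
  key \<open>f\<close>. The conclusion describes the elements listed before step \<open>i\<close>,
  which is how the permutation enters the definition of restricted parking functions.\<close>

lemma exists_sorting_perm:
  fixes f :: "nat \<Rightarrow> 'b::linorder"
  assumes "inj_on f {1..n}"
  shows "\<exists>\<alpha>. \<alpha> permutes {1..n} \<and> (\<forall>i\<in>{1..n}. \<alpha> ` {1..<i} = {a \<in> {1..n}. f a < f (\<alpha> i)})"
proof -
  define \<rho> where "\<rho> k = card {a \<in> {1..n}. f a \<le> f k}" for k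
  have mono: "\<rho> k < \<rho> l" if "l \<in> {1..n}" "f k < f l" for k l
  proof -
    have "l \<in> {a \<in> {1..n}. f a \<le> f l} - {a \<in> {1..n}. f a \<le> f k}" using that by auto
    moreover have "{a \<in> {1..n}. f a \<le> f k} \<subseteq> {a \<in> {1..n}. f a \<le> f l}" using that by auto
    ultimately show ?thesis unfolding \<rho>_def by (intro psubset_card_mono) auto
  qed
  then have mono_iff: "f k < f l \<longleftrightarrow> \<rho> k < \<rho> l" if "k \<in> {1..n}" "l \<in> {1..n}" for k l
    using that assms by (metis inj_onD less_asym linorder_neqE)
  have inj: "inj_on \<rho> {1..n}"
    using mono_iff assms by (intro inj_onI) (metis inj_onD less_irrefl linorder_neqE)
  have "\<rho> k \<in> {1..n}" if "k \<in> {1..n}" for k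
  proof -
    have "\<rho> k \<noteq> 0" using that by (auto simp: \<rho>_def)
    moreover have "\<rho> k \<le> card {1..n}" unfolding \<rho>_def by (intro card_mono) auto
    ultimately show ?thesis by simp
  qed
  with inj have perm: "(\<lambda>k. if k \<in> {1..n} then \<rho> k else k) permutes {1..n}" (is "?\<pi> permutes _")
    by (intro permutes_restrict) auto
  have "inv_into UNIV ?\<pi> ` {1..<i} = {a \<in> {1..n}. f a < f (inv_into UNIV ?\<pi> i)}" if i: "i \<in> {1..n}" for i
  proof -
    have inv: "inv_into UNIV ?\<pi> m \<in> {1..n}" "\<rho> (inv_into UNIV ?\<pi> m) = m" if "m \<in> {1..n}" for m
      using permutes_inverses(1)[OF perm, of m] permutes_in_image[OF permutes_inv[OF perm], of m] that
      by (auto split: if_splits)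
    have "inv_into UNIV ?\<pi> (\<rho> a) = a" if "a \<in> {1..n}" for a
      using permutes_inverses(2)[OF perm, of a] that by simp
    moreover have \<rho>: "\<rho> a \<in> {1..n}" if "a \<in> {1..n}" for a
      using that permutes_in_image[OF perm, of a] by simp
    ultimately have "{a \<in> {1..n}. \<rho> a < i} \<subseteq> inv_into UNIV ?\<pi> ` {1..<i}"
      by (smt (verit, best) atLeastAtMost_iff atLeastLessThan_iff image_iff mem_Collect_eq subsetI)
    moreover have "inv_into UNIV ?\<pi> ` {1..<i} \<subseteq> {a \<in> {1..n}. \<rho> a < i}"
    proof
      fix a assume "a \<in> inv_into UNIV ?\<pi> ` {1..<i}"
      then obtain m where "a = inv_into UNIV ?\<pi> m" "m \<in> {1..<i}" by blast
      then show "a \<in> {a \<in> {1..n}. \<rho> a < i}" using inv[of m] i by simp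
    qed
    ultimately have "inv_into UNIV ?\<pi> ` {1..<i} = {a \<in> {1..n}. \<rho> a < i}" by blast
    also have "\<dots> = {a \<in> {1..n}. f a < f (inv_into UNIV ?\<pi> i)}"
      using mono_iff[OF _ inv(1)[OF i]] unfolding inv(2)[OF i] by blast
    finally show ?thesis .
  qed
  with permutes_inv[OF perm] show ?thesis by blast
qed

text \<open>This expresses the bound through the set \<open>A\<close> of elements already removed.
  If \<open>j\<close> has rank \<open>s\<close> in the complement, then \<open>j - s\<close> counts
  the elements of \<open>A\<close> below \<open>j\<close>, so the index of \<open>u\<close> in the
  second case is \<open>n\<close> minus the number of elements of \<open>A\<close> above
  \<open>j\<close>.\<close>

lemma mu_complement:
  assumes u: "\<And>i. i \<in> {1..n} \<Longrightarrow> u i = u1 + (i - 1) * b"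
    and "A \<subseteq> {1..n}" "j \<in> {1..n} - A"
  shows "mu n u c j ({1..n} - A) =
    c + b * (if j = Min ({1..n} - A) then card A else card (A \<inter> {j<..}))"
proof -
  \<comment> \<open>Here \<open>v < n\<close> keeps the index \<open>n - v\<close> in the range
    where \<open>u\<close> is an arithmetic progression.\<close>
  have u_diff: "u n - u (n - v) + c = c + b * v" if "v < n" for v
  proof -
    have "u n - u (n - v) = (n - 1) * b - (n - v - 1) * b" using that by (simp add: u)
    also have "\<dots> = (n - 1 - (n - v - 1)) * b" by (rule diff_mult_distrib[symmetric])
    also have "n - 1 - (n - v - 1) = v" using that by simp
    finally show ?thesis by simp
  qed
  have fin: "finite A" using assms(2) finite_subset by blast
  have "A \<subset> {1..n}" using assms(2,3) by blast
  then have cardA: "card ({1..n} - A) = n - card A" "card A < n"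
    using psubset_card_mono[of "{1..n}" A] fin by (auto simp: card_Diff_subset)
  have "{i \<in> {1..n} - A. i \<le> j} = {1..j} - A \<inter> {..j}" using assms(2,3) by auto
  moreover have "A \<inter> {..j} \<subseteq> {1..j}" using assms(2,3) by auto
  ultimately have "card {i \<in> {1..n} - A. i \<le> j} = j - card (A \<inter> {..j})"
    using fin by (simp add: card_Diff_subset)
  moreover have "card A = card (A \<inter> {..j}) + card (A \<inter> {j<..})"
    using fin by (subst card_Un_disjoint[symmetric]) (auto intro!: arg_cong[of _ _ card])
  moreover have "card (A \<inter> {..j}) \<le> j"
    using card_mono[OF _ \<open>A \<inter> {..j} \<subseteq> {1..j}\<close>] by simp
  ultimately have "card ({1..n} - A) + j - card {i \<in> {1..n} - A. i \<le> j} = n - card (A \<inter> {j<..})"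
    "card (A \<inter> {j<..}) < n"
    using cardA by auto
  then show ?thesis
    unfolding mu_def using u_diff cardA by simp
qed

lemma admissible_imp_removal_order:
  assumes u: "\<And>i. i \<in> {1..n} \<Longrightarrow> u i = u1 + (i - 1) * b"
    and adm: "admissible n b c U p"
  shows "\<exists>\<alpha>. \<alpha> permutes {1..n} \<and>
            (\<forall>i\<in>{1..n}. p (\<alpha> i) < mu n u c (\<alpha> i) ({1..n} - \<alpha> ` {1..<i}))"
proof -
  have U: "U \<subseteq> {1..n}" and fin: "finite U"
    using adm by (auto simp: admissible_def intro: finite_subset)
  \<comment> \<open>Sorting by this key puts \<open>U\<close> first, in decreasing order, and then
    the other elements in increasing order. Positions start at 1, so the two groups have keys of
    opposite sign.\<close>
  define f where "f k = (if k \<in> U then - int k else int k)" for k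
  have "inj_on f {1..n}" by (auto simp: inj_on_def f_def)
  from exists_sorting_perm[OF this] obtain \<alpha> where \<alpha>: "\<alpha> permutes {1..n}"
      "\<forall>i\<in>{1..n}. \<alpha> ` {1..<i} = {a \<in> {1..n}. f a < f (\<alpha> i)}"
    by (elim exE conjE)
  have "p k < mu n u c k ({1..n} - {a \<in> {1..n}. f a < f k})" if k: "k \<in> {1..n}" for k
  proof -
    let ?A = "{a \<in> {1..n}. f a < f k}"
    have mu: "mu n u c k ({1..n} - ?A) =
      c + b * (if k = Min ({1..n} - ?A) then card ?A else card (?A \<inter> {k<..}))"
      by (rule mu_complement[where ?u1.0 = u1 and b = b]) (use u k in auto)
    have p: "p k < c + b * ((if k \<in> U then 0 else k - 1) + card (U \<inter> {k<..}))"
      using adm k by (auto simp: admissible_def)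
    show ?thesis
    proof (cases "k \<in> U")
      case True
      \<comment> \<open>All elements removed before \<open>k\<close> lie above \<open>k\<close>, so
        both cases of \<open>mu\<close> give the same bound.\<close>
      have "?A = U \<inter> {k<..}" using U k True by (auto simp: f_def split: if_splits)
      then have "card ?A = card (U \<inter> {k<..})" "card (?A \<inter> {k<..}) = card (U \<inter> {k<..})"
        by (auto intro: arg_cong[of _ _ card])
      then show ?thesis using p True unfolding mu by simp
    next
      case False
      \<comment> \<open>Everything below \<open>k\<close> is gone, so \<open>k\<close> is the
        minimum of what remains and \<open>mu\<close> counts all removed elements.\<close>
      have A: "?A = {1..<k} \<union> U \<inter> {k<..}" using U k False by (auto simp: f_def split: if_splits)
      have "k = Min ({1..n} - ?A)"
      proof (rule Min_eqI[symmetric])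
        show "finite ({1..n} - ?A)" by simp
        show "k \<in> {1..n} - ?A" using k by simp
        fix y assume "y \<in> {1..n} - ?A"
        then have "y \<notin> {1..<k}" "1 \<le> y" unfolding A by auto
        then show "k \<le> y" by simp
      qed
      moreover have "card ?A = k - 1 + card (U \<inter> {k<..})"
        unfolding A using fin by (subst card_Un_disjoint) auto
      ultimately show ?thesis using p False unfolding mu by simp
    qed
  qed
  then have "p (\<alpha> i) < mu n u c (\<alpha> i) ({1..n} - \<alpha> ` {1..<i})" if "i \<in> {1..n}" for i
    using that permutes_in_image[OF \<alpha>(1), of i] \<alpha>(2) by metis
  with \<alpha>(1) show ?thesis by blast
qed

text \<open>With respect to the greedy set, an element outside it can only be removed as the minimum:
  otherwise the elements removed before it and larger than it would all lie in the greedy set.\<close>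

lemma removal_order_imp_admissible:
  assumes u: "\<And>i. i \<in> {1..n} \<Longrightarrow> u i = u1 + (i - 1) * b"
    and \<alpha>: "\<alpha> permutes {1..n}"
    and p: "\<forall>i\<in>{1..n}. p (\<alpha> i) < mu n u c (\<alpha> i) ({1..n} - \<alpha> ` {1..<i})"
    and U: "greedy n b c U p"
  shows "admissible n b c U p"
proof -
  have fin: "finite U" and sub: "U \<subseteq> {1..n}" using U finite_subset by (auto simp: greedy_def)
  \<comment> \<open>The inclusion says that \<open>\<alpha> i\<close> is removed as the minimum; it
    is part of the induction claim because the argument for \<open>i\<close> applies it to earlier
    elements outside \<open>U\<close>.\<close>
  have "{1..<\<alpha> i} \<subseteq> \<alpha> ` {1..<i} \<and> p (\<alpha> i) < c + b * (\<alpha> i - 1 + card (U \<inter> {\<alpha> i<..}))"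
    if "i \<in> {1..n}" "\<alpha> i \<notin> U" for i
    using that
  proof (induction i rule: less_induct)
    case (less i)
    define k A where "k = \<alpha> i" and "A = \<alpha> ` {1..<i}"
    have k: "k \<in> {1..n}" using less.prems permutes_in_image[OF \<alpha>, of i] by (simp add: k_def)
    have A: "A \<subseteq> {1..n}" "finite A"
      using less.prems image_mono[of "{1..<i}" "{1..n}" \<alpha>] permutes_image[OF \<alpha>] by (auto simp: A_def)
    have "k \<notin> A" by (simp add: k_def A_def inj_image_mem_iff[OF permutes_inj[OF \<alpha>]])
    then have "mu n u c k ({1..n} - A) =
        c + b * (if k = Min ({1..n} - A) then card A else card (A \<inter> {k<..}))"
      by (intro mu_complement[where ?u1.0 = u1 and b = b]) (use u k A in auto)
    moreover have "p k < mu n u c k ({1..n} - A)"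
      using p less.prems(1) unfolding k_def A_def by blast
    ultimately have mu: "p k < c + b * (if k = Min ({1..n} - A) then card A else card (A \<inter> {k<..}))"
      by simp
    \<comment> \<open>If \<open>a\<close> were outside \<open>U\<close>, everything below
      \<open>a\<close> would have been removed before \<open>a\<close> by induction, and
      \<open>k\<close> with it.\<close>
    have "a \<in> U" if a: "a \<in> A" "k < a" for a
    proof (rule ccontr)
      assume "a \<notin> U"
      obtain m where m: "a = \<alpha> m" "m \<in> {1..<i}" using a(1) by (auto simp: A_def)
      then have "{1..<a} \<subseteq> \<alpha> ` {1..<m}"
        using less.IH[of m] less.prems \<open>a \<notin> U\<close> by auto
      then have "k \<in> \<alpha> ` {1..<m}" using a(2) k by auto
      then have "k \<in> A" using m by (auto simp: A_def)
      with \<open>k \<notin> A\<close> show False by simp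
    qed
    then have above: "card (A \<inter> {k<..}) \<le> card (U \<inter> {k<..})"
      using fin by (intro card_mono) auto
    \<comment> \<open>A non-minimal \<open>k\<close> would satisfy the first bound with respect to
      \<open>U\<close>, so the greedy condition would put it into \<open>U\<close>.\<close>
    have min: "k = Min ({1..n} - A)"
    proof (rule ccontr)
      assume "k \<noteq> Min ({1..n} - A)"
      with mu have "p k < c + b * card (A \<inter> {k<..})" by presburger
      moreover have "c + b * card (A \<inter> {k<..}) \<le> c + b * card (U \<inter> {k<..})"
        using above by simp
      moreover have "c + b * card (U \<inter> {k<..}) \<le> p k"
        using U k less.prems by (auto simp: greedy_def k_def)
      ultimately show False by linarith
    qed
    have "{1..<k} \<subseteq> A"
    proof
      fix x assume x: "x \<in> {1..<k}"
      show "x \<in> A"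
      proof (rule ccontr)
        assume "x \<notin> A"
        then have "k \<le> x" unfolding min using x k by (intro Min_le) auto
        with x show False by simp
      qed
    qed
    have "A \<subseteq> {1..<k} \<union> A \<inter> {k<..}"
    proof
      fix x assume "x \<in> A"
      then have "x \<noteq> k" "x \<in> {1..n}" using A(1) \<open>k \<notin> A\<close> by blast+
      with \<open>x \<in> A\<close> show "x \<in> {1..<k} \<union> A \<inter> {k<..}" by auto
    qed
    then have "card A \<le> card ({1..<k} \<union> A \<inter> {k<..})"
      using A(2) by (intro card_mono) auto
    then have "card A \<le> k - 1 + card (U \<inter> {k<..})"
      using above card_Un_le[of "{1..<k}" "A \<inter> {k<..}"] by simp
    then have "c + b * card A \<le> c + b * (k - 1 + card (U \<inter> {k<..}))"
      by (intro add_left_mono mult_left_mono) auto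
    moreover have "p k < c + b * card A" using mu min by presburger
    ultimately have "p k < c + b * (k - 1 + card (U \<inter> {k<..}))" by linarith
    with \<open>{1..<k} \<subseteq> A\<close> show ?case unfolding k_def A_def by blast
  qed
  moreover have "k \<in> \<alpha> ` {1..n}" if "k \<in> {1..n}" for k
    using that permutes_image[OF \<alpha>] by simp
  ultimately have "p k < c + b * (k - 1 + card (U \<inter> {k<..}))" if "k \<in> {1..n}" "k \<notin> U" for k
    using that by blast
  with U show ?thesis by (auto simp: admissible_def greedy_def)
qed

text \<open>If entry \<open>j\<close> of the sorted list were at least \<open>x\<close>, every entry
  below \<open>x\<close> would have an index smaller than \<open>j\<close>, leaving at most
  \<open>j\<close> of them.\<close>

lemma sort_nth_less:
  fixes xs :: "'b::linorder list"
  assumes "j < length (filter (\<lambda>y. y < x) xs)"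
  shows "sort xs ! j < x"
proof (rule ccontr)
  assume "\<not> sort xs ! j < x"
  have "length (filter (\<lambda>y. y < x) xs) = length (filter (\<lambda>y. y < x) (sort xs))"
    by (simp add: filter_sort)
  also have "\<dots> = card {i. i < length (sort xs) \<and> sort xs ! i < x}"
    by (rule length_filter_conv_card)
  also have "\<dots> \<le> card {..<j}"
  proof (rule card_mono)
    show "{i. i < length (sort xs) \<and> sort xs ! i < x} \<subseteq> {..<j}"
    proof
      fix i assume "i \<in> {i. i < length (sort xs) \<and> sort xs ! i < x}"
      moreover have "sort xs ! j \<le> sort xs ! i" if "j \<le> i" "i < length (sort xs)"
        using that by (intro sorted_nth_mono) auto
      ultimately show "i \<in> {..<j}" using \<open>\<not> sort xs ! j < x\<close> by force
    qed
  qed simp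
  finally show False using assms by simp
qed

text \<open>The \<open>j\<close> positions that carry the \<open>j\<close> largest values of
  \<open>\<sigma>\<close> all have entries below \<open>c + b * (j - 1)\<close>, which is
  \<open>lam (n - j + 1)\<close>. So the \<open>j\<close> smallest entries are below this
  bound.\<close>

lemma parking_functionsI:
  assumes lam: "\<And>i. i \<in> {1..n} \<Longrightarrow> lam i = c + b * (n - i)"
    and \<sigma>: "\<sigma> permutes {1..n}" and p: "p \<in> {1..n} \<rightarrow>\<^sub>E UNIV" "\<And>i. i \<in> {1..n} \<Longrightarrow> p i < c + b * (n - \<sigma> i)"
  shows "p \<in> parking_functions n lam"
proof -
  have "sort (map p [1..<Suc n]) ! (j - 1) < lam (n - j + 1)" if j: "j \<in> {1..n}" for j
  proof (rule sort_nth_less)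
    let ?x = "lam (n - j + 1)"
    have x: "?x = c + b * (j - 1)" using j lam[of "n - j + 1"] by auto
    have "{i \<in> {1..n}. p i < ?x} \<supseteq> inv_into UNIV \<sigma> ` {n - j + 1..n}"
    proof
      fix i assume "i \<in> inv_into UNIV \<sigma> ` {n - j + 1..n}"
      then obtain v where v: "i = inv_into UNIV \<sigma> v" "v \<in> {n - j + 1..n}" by blast
      then have "\<sigma> i = v" using permutes_inverses(1)[OF \<sigma>] by simp
      have i: "i \<in> {1..n}" using v permutes_in_image[OF permutes_inv[OF \<sigma>]] by auto
      have "b * (n - v) \<le> b * (j - 1)" using v by (intro mult_left_mono) auto
      then have "p i < ?x" using p(2)[OF i, unfolded \<open>\<sigma> i = v\<close>] x by linarith
      with i show "i \<in> {i \<in> {1..n}. p i < ?x}" by simp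
    qed
    then have "card (inv_into UNIV \<sigma> ` {n - j + 1..n}) \<le> card {i \<in> {1..n}. p i < ?x}"
      by (intro card_mono) auto
    also have "card (inv_into UNIV \<sigma> ` {n - j + 1..n}) = j"
      using j by (subst card_image) (auto intro: inj_on_subset[OF permutes_inj[OF permutes_inv[OF \<sigma>]]])
    also have "card {i \<in> {1..n}. p i < ?x} = length (filter (\<lambda>y. y < ?x) (map p [1..<Suc n]))"
      by (simp add: filter_map distinct_length_filter del: upt_Suc) (auto intro!: arg_cong[of _ _ card])
    finally show "j - 1 < length (filter (\<lambda>y. y < ?x) (map p [1..<Suc n]))"
      using j unfolding atLeastAtMost_iff by linarith
  qed
  with p show ?thesis by (simp add: parking_functions_def)
qed

text \<open>A removal order makes the greedy set admissible. Conversely, an admissible set yields a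
  removal order, and through the associated permutation also the parking condition.\<close>

lemma restricted_parking_functions_eq:
  assumes u: "\<And>i. i \<in> {1..n} \<Longrightarrow> u i = u1 + (i - 1) * b"
    and lam: "\<And>i. i \<in> {1..n} \<Longrightarrow> lam i = c + b * (n - i)"
  shows "restricted_parking_functions n u c lam = {p \<in> {1..n} \<rightarrow>\<^sub>E UNIV. \<exists>U. admissible n b c U p}"
proof (intro equalityI subsetI)
  fix p assume "p \<in> restricted_parking_functions n u c lam"
  then show "p \<in> {p \<in> {1..n} \<rightarrow>\<^sub>E UNIV. \<exists>U. admissible n b c U p}"
    using removal_order_imp_admissible[where p = p and n = n and u = u, OF u] greedy_exists[of n b c p]
    by (auto simp: restricted_parking_functions_def parking_functions_def)
next
  fix p assume p: "p \<in> {p \<in> {1..n} \<rightarrow>\<^sub>E UNIV. \<exists>U. admissible n b c U p}"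
  then obtain U where "admissible n b c U p" by blast
  from admissible_imp_avoiding_perm[OF this] obtain \<sigma>
    where "\<sigma> \<in> avoiding_perms n {[1, 3, 2], [3, 1, 2]}" "\<forall>k\<in>{1..n}. p k < c + b * (n - \<sigma> k)"
    by blast
  with p lam have "p \<in> parking_functions n lam"
    by (intro parking_functionsI[of n lam c b \<sigma>]) (auto simp: avoiding_perms_def)
  with p show "p \<in> restricted_parking_functions n u c lam"
    using admissible_imp_removal_order[where p = p and n = n and u = u, OF u]
    by (auto simp: restricted_parking_functions_def)
qed

section \<open>Monomial ideals\<close>

lemma mpoly_ring_simps [simp]:
  "\<zero>\<^bsub>mpoly_ring n\<^esub> = 0" "\<one>\<^bsub>mpoly_ring n\<^esub> = 1"
  "x \<oplus>\<^bsub>mpoly_ring n\<^esub> y = x + y" "x \<otimes>\<^bsub>mpoly_ring n\<^esub> y = x * y"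
  by (simp_all add: mpoly_ring_def)

lemma mem_carrier_mpoly_ring:
  "p \<in> carrier (mpoly_ring n) \<longleftrightarrow> (\<forall>m\<in>Poly_Mapping.keys p. Poly_Mapping.keys m \<subseteq> {1..n})"
  by (simp add: mpoly_ring_def)

lemma keys_uminus: "Poly_Mapping.keys (- p) = Poly_Mapping.keys (p :: 'k::field mpoly)"
  by (auto simp: in_keys_iff)

lemma a_inv_mpoly_ring:
  assumes "p \<in> carrier (mpoly_ring n)"
  shows "\<ominus>\<^bsub>mpoly_ring n\<^esub> p = - (p :: 'k::field mpoly)"
proof -
  interpret cring "mpoly_ring n :: 'k mpoly ring" by (rule cring_mpoly_ring)
  show ?thesis
    using assms by (intro minus_equality) (auto simp: mem_carrier_mpoly_ring keys_uminus)
qed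

lemma single_mem_carrier:
  assumes "Poly_Mapping.keys m \<subseteq> {1..n}"
  shows "Poly_Mapping.single m (a :: 'k::field) \<in> carrier (mpoly_ring n)"
  using assms by (simp add: mem_carrier_mpoly_ring)

lemma poly_mapping_sum_single:
  "(\<Sum>m\<in>Poly_Mapping.keys p. Poly_Mapping.single m (Poly_Mapping.lookup p m)) = p"
proof (rule poly_mapping_eqI)
  fix k
  show "Poly_Mapping.lookup (\<Sum>m\<in>Poly_Mapping.keys p. Poly_Mapping.single m (Poly_Mapping.lookup p m)) k =
      Poly_Mapping.lookup p k"
    by (simp add: lookup_sum lookup_single when_def in_keys_iff)
qed

text \<open>The right-hand side is an ideal containing the generators, which gives one inclusion by
  minimality. For the other, a polynomial is the sum of its terms, and each term is a multiple of a
  generator.\<close>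

lemma genideal_xmonom:
  assumes G: "\<And>g. g \<in> G \<Longrightarrow> Poly_Mapping.keys g \<subseteq> {1..n}"
  shows "Idl\<^bsub>mpoly_ring n\<^esub> (xmonom ` G) =
    {p :: 'k::field mpoly. p \<in> carrier (mpoly_ring n) \<and>
       (\<forall>m\<in>Poly_Mapping.keys p. \<exists>g\<in>G. \<forall>i. Poly_Mapping.lookup g i \<le> Poly_Mapping.lookup m i)}"
    (is "?I = ?M")
proof
  interpret cring "mpoly_ring n :: 'k mpoly ring" by (rule cring_mpoly_ring)
  have sub: "xmonom ` G \<subseteq> carrier (mpoly_ring n :: 'k mpoly ring)"
    unfolding xmonom_def by (intro image_subsetI single_mem_carrier G)
  then interpret I: ideal ?I "mpoly_ring n :: 'k mpoly ring" by (rule genideal_ideal)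
  have mult: "x * a \<in> ?M" if a: "a \<in> ?M" and x: "x \<in> carrier (mpoly_ring n)" for a x
  proof -
    have "x * a \<in> carrier (mpoly_ring n)" using m_closed[of x a] a x by simp
    moreover have "\<exists>g\<in>G. \<forall>i. Poly_Mapping.lookup g i \<le> Poly_Mapping.lookup m i"
      if m: "m \<in> Poly_Mapping.keys (x * a)" for m
    proof -
      obtain s t where "m = s + t" "t \<in> Poly_Mapping.keys a"
        using m Poly_Mapping.keys_mult[of x a] by blast
      moreover from this obtain g where "g \<in> G" "\<forall>i. Poly_Mapping.lookup g i \<le> Poly_Mapping.lookup t i"
        using a by blast
      ultimately show ?thesis by (intro bexI[of _ g]) (auto simp: lookup_add trans_le_add2)
    qed
    ultimately show ?thesis by simp
  qed
  have "ideal ?M (mpoly_ring n)"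
  proof (rule idealI)
    show "ring (mpoly_ring n :: 'k mpoly ring)" by (rule ring_axioms)
    show "subgroup ?M (add_monoid (mpoly_ring n))"
    proof (rule add.subgroupI)
      show "?M \<noteq> {}" using zero_closed by auto
    next
      fix a assume "a \<in> ?M"
      then show "\<ominus>\<^bsub>mpoly_ring n\<^esub> a \<in> ?M"
        by (simp add: a_inv_mpoly_ring) (simp add: mem_carrier_mpoly_ring keys_uminus)
    next
      fix a b assume ab: "a \<in> ?M" "b \<in> ?M"
      then have "a + b \<in> carrier (mpoly_ring n)" using a_closed[of a b] by simp
      with ab show "a \<oplus>\<^bsub>mpoly_ring n\<^esub> b \<in> ?M"
        using Poly_Mapping.keys_add[of a b] by auto
    qed auto
  qed (use mult in \<open>auto simp: mult.commute\<close>)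
  moreover have "xmonom ` G \<subseteq> ?M"
    using sub by (auto simp: xmonom_def)
  ultimately show "?I \<subseteq> ?M" by (rule genideal_minimal)
  show "?M \<subseteq> ?I"
  proof
    fix p assume p: "p \<in> ?M"
    have summand: "Poly_Mapping.single m (Poly_Mapping.lookup p m) \<in> ?I" if m: "m \<in> Poly_Mapping.keys p" for m
    proof -
      obtain g where g: "g \<in> G" "\<forall>i. Poly_Mapping.lookup g i \<le> Poly_Mapping.lookup m i"
        using p m by blast
      have "Poly_Mapping.keys (m - g) \<subseteq> Poly_Mapping.keys m"
        by (auto simp: in_keys_iff lookup_minus)
      then have "Poly_Mapping.single (m - g) (Poly_Mapping.lookup p m) \<in> carrier (mpoly_ring n)"
        using p m by (intro single_mem_carrier) (auto simp: mem_carrier_mpoly_ring)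
      moreover have "xmonom g \<in> ?I" using g(1) genideal_self[OF sub] by blast
      ultimately have "Poly_Mapping.single (m - g) (Poly_Mapping.lookup p m) * xmonom g \<in> ?I"
        using I.I_l_closed by simp
      \<comment> \<open>The subtraction of exponents is truncated pointwise; it is exact because
        \<open>g\<close> divides \<open>m\<close>.\<close>
      moreover have "m - g + g = m"
        using g(2) by (intro poly_mapping_eqI) (simp add: lookup_add lookup_minus)
      ultimately show ?thesis by (simp add: xmonom_def mult_single)
    qed
    have "(\<Sum>m\<in>K. Poly_Mapping.single m (Poly_Mapping.lookup p m)) \<in> ?I"
      if "finite K" "K \<subseteq> Poly_Mapping.keys p" for K
      using that
    proof (induction K)
      case empty
      then show ?case using I.zero_closed by simp
    next
      case (insert m K)
      then show ?case using I.a_closed[OF summand[of m], of "\<Sum>m\<in>K. Poly_Mapping.single m (Poly_Mapping.lookup p m)"] by simp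
    qed
    from this[of "Poly_Mapping.keys p"] show "p \<in> ?I"
      by (simp add: poly_mapping_sum_single)
  qed
qed

lemma xvar_power: "(xvar i :: 'k::field mpoly) ^ d = xmonom (Poly_Mapping.single i d)"
  by (induction d) (simp_all add: xvar_def xmonom_def mult_single flip: single_add)

lemma irr_ideal_eq:
  "irr_ideal n d = {p :: 'k::field mpoly. p \<in> carrier (mpoly_ring n) \<and>
     (\<forall>m\<in>Poly_Mapping.keys p. \<exists>i\<in>{1..n}. 1 \<le> d i \<and> d i \<le> Poly_Mapping.lookup m i)}"
proof -
  let ?G = "{Poly_Mapping.single i (d i) | i. i \<in> {1..n} \<and> d i \<ge> 1}"
  have "{xvar i ^ d i | i. i \<in> {1..n} \<and> d i \<ge> 1} = (xmonom ` ?G :: 'k mpoly set)"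
    by (auto simp: xvar_power)
  then have "irr_ideal n d = Idl\<^bsub>mpoly_ring n\<^esub> (xmonom ` ?G :: 'k mpoly set)"
    by (simp add: irr_ideal_def)
  also have "\<dots> = {p. p \<in> carrier (mpoly_ring n) \<and>
       (\<forall>m\<in>Poly_Mapping.keys p. \<exists>g\<in>?G. \<forall>i. Poly_Mapping.lookup g i \<le> Poly_Mapping.lookup m i)}"
    by (rule genideal_xmonom) (auto split: if_splits)
  moreover have "(\<exists>g\<in>?G. \<forall>i. Poly_Mapping.lookup g i \<le> Poly_Mapping.lookup m i) \<longleftrightarrow>
      (\<exists>i\<in>{1..n}. 1 \<le> d i \<and> d i \<le> Poly_Mapping.lookup m i)" for m
    by (fastforce simp: lookup_single when_def split: if_splits)
  ultimately show ?thesis by simp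
qed

section \<open>Minimal generators of the permutation ideal\<close>

definition perm_exp :: "nat \<Rightarrow> (nat \<Rightarrow> nat) \<Rightarrow> (nat \<Rightarrow> nat) \<Rightarrow> (nat \<Rightarrow>\<^sub>0 nat)" where
  "perm_exp n u \<sigma> = (\<Sum>i\<in>{1..n}. Poly_Mapping.single i (u (\<sigma> i)))"

lemma lookup_perm_exp: "Poly_Mapping.lookup (perm_exp n u \<sigma>) i = (if i \<in> {1..n} then u (\<sigma> i) else 0)"
  by (simp add: perm_exp_def lookup_sum lookup_single when_def)

lemma keys_perm_exp: "Poly_Mapping.keys (perm_exp n u \<sigma>) \<subseteq> {1..n}"
  by (auto simp: in_keys_iff lookup_perm_exp split: if_splits)

lemma prod_xvar_power:
  assumes "finite A"
  shows "(\<Prod>i\<in>A. (xvar i :: 'k::field mpoly) ^ e i) = xmonom (\<Sum>i\<in>A. Poly_Mapping.single i (e i))"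
  using assms by (induction A) (simp_all add: xvar_power xmonom_def mult_single)

lemma xmonom_mem_perm_ideal_iff:
  "(xmonom m :: 'k::field mpoly) \<in> perm_ideal n W u \<longleftrightarrow> Poly_Mapping.keys m \<subseteq> {1..n} \<and>
     (\<exists>\<sigma>\<in>W. \<forall>i. Poly_Mapping.lookup (perm_exp n u \<sigma>) i \<le> Poly_Mapping.lookup m i)"
proof -
  have "{\<Prod>i\<in>{1..n}. xvar i ^ u (\<sigma> i) | \<sigma>. \<sigma> \<in> W} = (xmonom ` (perm_exp n u ` W) :: 'k mpoly set)"
    by (auto simp: prod_xvar_power perm_exp_def)
  then have "(perm_ideal n W u :: 'k mpoly set) = Idl\<^bsub>mpoly_ring n\<^esub> (xmonom ` (perm_exp n u ` W))"
    by (simp add: perm_ideal_def)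
  also have "\<dots> = {p. p \<in> carrier (mpoly_ring n) \<and> (\<forall>m\<in>Poly_Mapping.keys p. \<exists>g\<in>perm_exp n u ` W.
       \<forall>i. Poly_Mapping.lookup g i \<le> Poly_Mapping.lookup m i)}"
    by (rule genideal_xmonom) (use keys_perm_exp in blast)
  finally show ?thesis by (simp add: xmonom_def mem_carrier_mpoly_ring)
qed

text \<open>All generators have the same degree, hence none divides another one.\<close>

lemma min_gens_perm_ideal:
  assumes W: "\<And>\<sigma>. \<sigma> \<in> W \<Longrightarrow> \<sigma> permutes {1..n}"
  shows "min_gens n (perm_ideal n W u :: 'k::field mpoly set) = perm_exp n u ` W"
proof (intro equalityI subsetI)
  fix m assume m: "m \<in> min_gens n (perm_ideal n W u :: 'k mpoly set)"
  then obtain \<sigma> where \<sigma>: "\<sigma> \<in> W"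
      "\<forall>i. Poly_Mapping.lookup (perm_exp n u \<sigma>) i \<le> Poly_Mapping.lookup m i"
    by (auto simp: min_gens_def xmonom_mem_perm_ideal_iff)
  then have "xmonom (perm_exp n u \<sigma>) \<in> (perm_ideal n W u :: 'k mpoly set)"
    unfolding xmonom_mem_perm_ideal_iff using keys_perm_exp by blast
  with m \<sigma> show "m \<in> perm_exp n u ` W" unfolding min_gens_def by blast
next
  fix m assume "m \<in> perm_exp n u ` W"
  then obtain \<sigma> where \<sigma>: "m = perm_exp n u \<sigma>" "\<sigma> \<in> W" by blast
  have deg: "(\<Sum>i\<in>{1..n}. Poly_Mapping.lookup (perm_exp n u \<tau>) i) = (\<Sum>i\<in>{1..n}. u i)" if "\<tau> \<in> W" for \<tau>
    using sum.permute[OF W[OF that], of u] by (simp add: lookup_perm_exp comp_def)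
  have "d = m" if d: "xmonom d \<in> (perm_ideal n W u :: 'k mpoly set)"
      "\<forall>i. Poly_Mapping.lookup d i \<le> Poly_Mapping.lookup m i" for d
  proof -
    \<comment> \<open>Now \<open>d\<close> lies between the exponents belonging to
      \<open>\<tau>\<close> and \<open>\<sigma>\<close>, and these coincide because their degrees
      agree.\<close>
    obtain \<tau> where \<tau>: "\<tau> \<in> W" "\<forall>i. Poly_Mapping.lookup (perm_exp n u \<tau>) i \<le> Poly_Mapping.lookup d i"
      using d(1) by (auto simp: xmonom_mem_perm_ideal_iff)
    have le: "Poly_Mapping.lookup (perm_exp n u \<tau>) i \<le> Poly_Mapping.lookup m i" for i
      using \<tau>(2) d(2) le_trans by blast
    have "Poly_Mapping.lookup (perm_exp n u \<tau>) i = Poly_Mapping.lookup m i" if "i \<in> {1..n}" for i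
    proof (rule ccontr)
      assume "Poly_Mapping.lookup (perm_exp n u \<tau>) i \<noteq> Poly_Mapping.lookup m i"
      then have "(\<Sum>i\<in>{1..n}. Poly_Mapping.lookup (perm_exp n u \<tau>) i) < (\<Sum>i\<in>{1..n}. Poly_Mapping.lookup m i)"
        using le that by (intro sum_strict_mono_ex1) (auto simp: order.not_eq_order_implies_strict intro!: bexI[of _ i])
      then show False using deg \<tau>(1) \<sigma> by simp
    qed
    then have "Poly_Mapping.lookup (perm_exp n u \<tau>) = Poly_Mapping.lookup m"
      by (auto simp: \<sigma>(1) lookup_perm_exp fun_eq_iff)
    then show "d = m" using \<tau>(2) d(2) by (intro poly_mapping_eqI) (metis le_antisym)
  qed
  then show "m \<in> min_gens n (perm_ideal n W u :: 'k mpoly set)"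
    using \<sigma> keys_perm_exp by (auto simp: min_gens_def xmonom_mem_perm_ideal_iff)
qed

section \<open>Dimension of the quotient by a monomial ideal\<close>

text \<open>The dimension is taken over a subfield of the quotient ring; \<open>quot_scalars\<close>
  is the image of this one.\<close>

lemma subfield_constants: "subfield (range pconst) (mpoly_ring n :: 'k::field mpoly ring)"
proof -
  interpret cring "mpoly_ring n :: 'k mpoly ring" by (rule cring_mpoly_ring)
  have const: "pconst a \<in> carrier (mpoly_ring n)" for a :: 'k
    by (simp add: pconst_def single_mem_carrier)
  have mult: "pconst a * pconst b = pconst (a * b)" for a b :: 'k
    by (simp add: pconst_def mult_single)
  have "subring (range pconst) (mpoly_ring n :: 'k mpoly ring)"
  proof (rule subringI)
    show "range pconst \<subseteq> carrier (mpoly_ring n :: 'k mpoly ring)" using const by blast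
    show "\<one>\<^bsub>mpoly_ring n\<^esub> \<in> range (pconst :: 'k \<Rightarrow> _)"
      by (rule range_eqI[of _ _ 1]) (simp add: pconst_def)
    fix x y :: "'k mpoly"
    assume x: "x \<in> range pconst"
    then obtain a where a: "x = pconst a" by blast
    have "\<ominus>\<^bsub>mpoly_ring n\<^esub> x = pconst (- a)"
      using const by (simp add: a a_inv_mpoly_ring) (simp add: pconst_def single_uminus)
    then show "\<ominus>\<^bsub>mpoly_ring n\<^esub> x \<in> range pconst" by simp
    assume y: "y \<in> range pconst"
    then obtain b where b: "y = pconst b" by blast
    show "x \<otimes>\<^bsub>mpoly_ring n\<^esub> y \<in> range pconst" by (simp add: a b mult)
    have "x + y = pconst (a + b)" by (simp add: a b pconst_def single_add)
    then show "x \<oplus>\<^bsub>mpoly_ring n\<^esub> y \<in> range pconst" by simp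
  qed
  moreover have "Units ((mpoly_ring n)\<lparr>carrier := range pconst\<rparr>) = range pconst - {\<zero>\<^bsub>mpoly_ring n :: 'k mpoly ring\<^esub>}"
  proof (intro equalityI subsetI)
    fix x :: "'k mpoly" assume "x \<in> Units ((mpoly_ring n)\<lparr>carrier := range pconst\<rparr>)"
    then show "x \<in> range pconst - {\<zero>\<^bsub>mpoly_ring n\<^esub>}" by (auto simp: Units_def)
  next
    fix x :: "'k mpoly" assume x: "x \<in> range pconst - {\<zero>\<^bsub>mpoly_ring n\<^esub>}"
    then obtain a where "x = pconst a" by blast
    with x have a: "x = pconst a" "a \<noteq> 0" by (auto simp: pconst_def)
    have "pconst (inverse a) * pconst a = 1"
      using a(2) by (simp add: mult) (simp add: pconst_def)
    then show "x \<in> Units ((mpoly_ring n)\<lparr>carrier := range pconst\<rparr>)"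
      unfolding Units_def by (auto simp: a(1) mult.commute intro!: exI[of _ "inverse a"])
  qed
  ultimately show ?thesis by (intro subfieldI subcringI')
qed

text \<open>The classes of the monomials with exponent in \<open>S\<close> form a basis. The
  dimension is built up one monomial at a time: \<open>E F\<close> is the span of the classes with
  exponents in \<open>F\<close>, and each new monomial is a line extension.\<close>

lemma dim_quot_monomial_ideal:
  fixes J :: "'k::field mpoly set"
  assumes ideal: "ideal J (mpoly_ring n)"
    and J: "\<And>p. p \<in> J \<longleftrightarrow> p \<in> carrier (mpoly_ring n) \<and> Poly_Mapping.keys p \<inter> S = {}"
    and S: "finite S" "\<And>m. m \<in> S \<Longrightarrow> Poly_Mapping.keys m \<subseteq> {1..n}" "0 \<in> S"
  shows "finite_dim_quot n J" "dim_quot n J = card S"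
proof -
  let ?R = "mpoly_ring n :: 'k mpoly ring"
  let ?Q = "?R Quot J"
  define \<phi> where "\<phi> = (\<lambda>p. J +>\<^bsub>?R\<^esub> p)"
  interpret R: cring ?R by (rule cring_mpoly_ring)
  interpret J: ideal J ?R by (rule ideal)
  interpret h: ring_hom_ring ?R ?Q \<phi>
    unfolding \<phi>_def by (rule J.rcos_ring_hom_ring)
  define K where "K = \<phi> ` range pconst"
  have K: "K = quot_scalars n J" by (auto simp: K_def quot_scalars_def \<phi>_def)
  have self: "p \<in> \<phi> p" if "p \<in> carrier ?R" for p
    using J.a_rcos_self[OF that] by (simp add: \<phi>_def)
  have const: "pconst a \<in> carrier ?R" for a
    by (simp add: pconst_def single_mem_carrier)
  have zero: "\<phi> p = \<zero>\<^bsub>?Q\<^esub>" if "p \<in> J" for p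
    using J.a_rcos_const[OF that] by (simp add: \<phi>_def FactRing_def)
  have subfield: "subfield K ?Q"
    unfolding K_def
  proof (rule h.img_is_subfield(2)[OF subfield_constants])
    \<comment> \<open>The exponent 0 lies in \<open>S\<close>, so the ideal is proper and the
      scalars embed as a field.\<close>
    have "1 \<notin> J" using S(3) by (simp add: J)
    moreover have "\<one>\<^bsub>?Q\<^esub> = \<phi> 1" "\<zero>\<^bsub>?Q\<^esub> = J" by (simp_all add: FactRing_def \<phi>_def)
    ultimately show "\<one>\<^bsub>?Q\<^esub> \<noteq> \<zero>\<^bsub>?Q\<^esub>" using self[of 1] R.one_closed by auto
  qed
  define E where "E F = \<phi> ` {p. Poly_Mapping.keys p \<subseteq> F}" for F
  have carrierI: "p \<in> carrier ?R" if "Poly_Mapping.keys p \<subseteq> F" "F \<subseteq> S" for p F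
    using that S(2) by (auto simp: mem_carrier_mpoly_ring)
  have "h.S.dimension (card F) K (E F)" if "F \<subseteq> S" for F
    using finite_subset[OF that S(1)] that
  proof (induction F)
    case empty
    have "{p :: 'k mpoly. Poly_Mapping.keys p \<subseteq> {}} = {0}" by auto
    then have "E {} = {\<zero>\<^bsub>?Q\<^esub>}" using h.hom_zero by (simp add: E_def)
    then show ?case by simp
  next
    case (insert m F)
    let ?v = "\<phi> (xmonom m)"
    have m: "xmonom m \<in> carrier ?R" using S(2) insert.prems by (simp add: xmonom_def single_mem_carrier)
    \<comment> \<open>Otherwise the ideal would contain a polynomial whose coefficient at
      \<open>m\<close>, an element of \<open>S\<close>, is 1.\<close>
    have "?v \<notin> E F"
    proof
      assume "?v \<in> E F"
      then obtain p where p: "Poly_Mapping.keys p \<subseteq> F" "\<phi> (xmonom m) = \<phi> p" by (auto simp: E_def)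
      have "xmonom m \<in> J +>\<^bsub>?R\<^esub> p" using self[OF m] p(2) by (simp add: \<phi>_def)
      then obtain j where j: "j \<in> J" "xmonom m = j + p"
        by (auto simp: a_r_coset_def')
      have "Poly_Mapping.lookup p m = 0" using p(1) insert.hyps by (auto simp: in_keys_iff)
      then have "Poly_Mapping.lookup j m = 1"
        using arg_cong[OF j(2), of "\<lambda>q. Poly_Mapping.lookup q m"] by (simp add: xmonom_def lookup_add)
      then have "m \<in> Poly_Mapping.keys j \<inter> S" using insert.prems by (simp add: in_keys_iff)
      with j(1) show False by (auto simp: J)
    qed
    moreover have "h.S.line_extension K ?v (E F) = E (insert m F)"
    proof (intro equalityI subsetI)
      fix u assume "u \<in> h.S.line_extension K ?v (E F)"
      then obtain a p where p: "Poly_Mapping.keys p \<subseteq> F"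
          "u = \<phi> (pconst a) \<otimes>\<^bsub>?Q\<^esub> ?v \<oplus>\<^bsub>?Q\<^esub> \<phi> p"
        by (auto simp: h.S.line_extension_mem_iff K_def E_def)
      have "p \<in> carrier ?R" using p(1) insert.prems by (intro carrierI[of p F]) auto
      then have "u = \<phi> (pconst a * xmonom m + p)"
        using p(2) m const[of a] h.hom_mult[of "pconst a" "xmonom m"] R.m_closed[of "pconst a" "xmonom m"]
          h.hom_add[of "pconst a * xmonom m" p] by simp
      moreover have "Poly_Mapping.keys (pconst a * xmonom m + p) \<subseteq> insert m F"
        using p(1) Poly_Mapping.keys_add[of "pconst a * xmonom m" p]
        by (auto simp: pconst_def xmonom_def mult_single split: if_splits)
      ultimately show "u \<in> E (insert m F)" by (auto simp: E_def)
    next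
      fix u assume "u \<in> E (insert m F)"
      then obtain q where q: "Poly_Mapping.keys q \<subseteq> insert m F" "u = \<phi> q" by (auto simp: E_def)
      define a where "a = Poly_Mapping.lookup q m"
      define p where "p = q - Poly_Mapping.single m a"
      have p: "Poly_Mapping.keys p \<subseteq> F"
      proof
        fix x assume "x \<in> Poly_Mapping.keys p"
        then have "Poly_Mapping.lookup q x \<noteq> Poly_Mapping.lookup (Poly_Mapping.single m a) x"
          by (simp add: p_def in_keys_iff lookup_minus)
        then have "x \<noteq> m" "Poly_Mapping.lookup q x \<noteq> 0"
          by (auto simp: a_def lookup_single when_def split: if_splits)
        then show "x \<in> F" using q(1) by (auto simp: in_keys_iff)
      qed
      then have pc: "p \<in> carrier ?R" using insert.prems by (intro carrierI[of p F]) auto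
      have "q = pconst a * xmonom m + p" by (simp add: p_def pconst_def xmonom_def mult_single)
      then have "u = \<phi> (pconst a) \<otimes>\<^bsub>?Q\<^esub> ?v \<oplus>\<^bsub>?Q\<^esub> \<phi> p"
        using q(2) m pc const[of a] h.hom_mult[of "pconst a" "xmonom m"] R.m_closed[of "pconst a" "xmonom m"]
          h.hom_add[of "pconst a * xmonom m" p] by simp
      then show "u \<in> h.S.line_extension K ?v (E F)"
        using p by (auto simp: h.S.line_extension_mem_iff K_def E_def)
    qed
    ultimately show ?case
      using h.S.dimension.Suc_dim[of ?v "E F" "card F" K] insert h.hom_closed[OF m] by simp
  qed
  from this[of S] have "h.S.dimension (card S) K (E S)" by simp
  moreover have "E S = carrier ?Q"
  proof (intro equalityI subsetI)
    fix u assume "u \<in> E S"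
    then show "u \<in> carrier ?Q" using h.hom_closed carrierI[of _ S] by (auto simp: E_def)
  next
    fix u assume "u \<in> carrier ?Q"
    then obtain p where p: "p \<in> carrier ?R" "u = \<phi> p"
      by (auto simp: FactRing_def A_RCOSETS_def' \<phi>_def)
    \<comment> \<open>The part of \<open>p\<close> supported on \<open>S\<close>; the remaining
      terms lie in the ideal.\<close>
    define r where "r = (\<Sum>m\<in>Poly_Mapping.keys p \<inter> S. Poly_Mapping.single m (Poly_Mapping.lookup p m))"
    have r: "Poly_Mapping.lookup r k = (if k \<in> S then Poly_Mapping.lookup p k else 0)" for k
      by (simp add: r_def lookup_sum lookup_single when_def in_keys_iff)
    have keys_r: "Poly_Mapping.keys r \<subseteq> S" "Poly_Mapping.keys r \<subseteq> Poly_Mapping.keys p"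
      by (auto simp: in_keys_iff r split: if_splits)
    have "Poly_Mapping.keys (p - r) \<subseteq> Poly_Mapping.keys p" "Poly_Mapping.keys (p - r) \<inter> S = {}"
      by (auto simp: in_keys_iff lookup_minus r split: if_splits)
    then have pr: "p - r \<in> J" using p(1) by (auto simp: J mem_carrier_mpoly_ring)
    have "r \<in> carrier ?R" using keys_r carrierI by blast
    then have "\<phi> p = \<phi> (p - r) \<oplus>\<^bsub>?Q\<^esub> \<phi> r"
      using h.hom_add[of "p - r" r] pr by (simp add: J)
    also have "\<dots> = \<phi> r" using zero[OF pr] h.hom_closed[OF \<open>r \<in> carrier ?R\<close>] by simp
    finally show "u \<in> E S" using p(2) keys_r by (auto simp: E_def)
  qed
  ultimately have dim: "h.S.dimension (card S) K (carrier ?Q)" by simp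
  then show "finite_dim_quot n J"
    unfolding finite_dim_quot_def K[symmetric] by (rule h.S.finite_dimensionI)
  show "dim_quot n J = card S"
    unfolding dim_quot_def K[symmetric]
    using h.S.dimI[OF subfield dim] by (simp add: over_def)
qed

section \<open>Standard monomials of the Alexander dual\<close>

text \<open>With \<open>lam v = a + 1 - u v\<close> these are the exponents of the monomials outside
  the Alexander dual, whose classes are a basis of the quotient.\<close>

definition std_exps :: "nat \<Rightarrow> (nat \<Rightarrow> nat) \<Rightarrow> (nat \<Rightarrow> nat) set \<Rightarrow> (nat \<Rightarrow>\<^sub>0 nat) set" where
  "std_exps n lam W = {m. Poly_Mapping.keys m \<subseteq> {1..n} \<and>
     (\<exists>\<sigma>\<in>W. \<forall>i\<in>{1..n}. Poly_Mapping.lookup m i < lam (\<sigma> i))}"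

text \<open>Membership in an irreducible component is decided term by term: each monomial must reach
  one of the bounds \<open>a + 1 - u (\<sigma> i)\<close>. A monomial stays outside the intersection
  exactly if it is below all bounds for some \<open>\<sigma>\<close>.\<close>

lemma mem_alexander_dual_perm_ideal_iff:
  fixes p :: "'k::field mpoly"
  assumes W: "\<And>\<sigma>. \<sigma> \<in> W \<Longrightarrow> \<sigma> permutes {1..n}"
    and u: "\<And>i. i \<in> {1..n} \<Longrightarrow> 1 \<le> u i \<and> u i \<le> a"
  shows "p \<in> alexander_dual n (\<lambda>_. a) (perm_ideal n W u) \<longleftrightarrow>
    p \<in> carrier (mpoly_ring n) \<and> Poly_Mapping.keys p \<inter> std_exps n (\<lambda>v. a + 1 - u v) W = {}"
proof -
  \<comment> \<open>\<open>1 \<le> u i\<close> selects the nonzero case of \<open>dual_exp\<close>,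
    and \<open>u i \<le> a\<close> makes the result positive, so every variable contributes a
    generator.\<close>
  have dual: "dual_exp (\<lambda>_. a) (perm_exp n u \<sigma>) i = a + 1 - u (\<sigma> i)" "1 \<le> a + 1 - u (\<sigma> i)"
    if "\<sigma> \<in> W" "i \<in> {1..n}" for \<sigma> i
    using u[of "\<sigma> i"] that permutes_in_image[OF W[OF that(1)], of i]
    by (simp_all add: dual_exp_def lookup_perm_exp Suc_le_eq less_Suc_eq_le)
  have min_gens: "min_gens n (perm_ideal n W u :: 'k mpoly set) = perm_exp n u ` W"
    by (rule min_gens_perm_ideal[OF W])
  have irr: "p \<in> irr_ideal n (dual_exp (\<lambda>_. a) (perm_exp n u \<sigma>)) \<longleftrightarrow> p \<in> carrier (mpoly_ring n) \<and>
      (\<forall>m\<in>Poly_Mapping.keys p. \<exists>i\<in>{1..n}. a + 1 - u (\<sigma> i) \<le> Poly_Mapping.lookup m i)"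
    if "\<sigma> \<in> W" for \<sigma>
    unfolding irr_ideal_eq mem_Collect_eq
    by (intro conj_cong ball_cong bex_cong refl) (simp only: dual[OF that] simp_thms)
  have "p \<in> alexander_dual n (\<lambda>_. a) (perm_ideal n W u) \<longleftrightarrow> p \<in> carrier (mpoly_ring n) \<and>
      (\<forall>\<sigma>\<in>W. p \<in> irr_ideal n (dual_exp (\<lambda>_. a) (perm_exp n u \<sigma>)))"
    by (simp add: alexander_dual_def min_gens)
  also have "\<dots> \<longleftrightarrow> p \<in> carrier (mpoly_ring n) \<and>
      (\<forall>\<sigma>\<in>W. \<forall>m\<in>Poly_Mapping.keys p. \<exists>i\<in>{1..n}. a + 1 - u (\<sigma> i) \<le> Poly_Mapping.lookup m i)"
    using irr by blast
  also have "\<dots> \<longleftrightarrow> p \<in> carrier (mpoly_ring n) \<and> Poly_Mapping.keys p \<inter> std_exps n (\<lambda>v. a + 1 - u v) W = {}"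
  proof -
    have "m \<notin> std_exps n (\<lambda>v. a + 1 - u v) W \<longleftrightarrow>
        (\<forall>\<sigma>\<in>W. \<exists>i\<in>{1..n}. a + 1 - u (\<sigma> i) \<le> Poly_Mapping.lookup m i)"
      if "Poly_Mapping.keys m \<subseteq> {1..n}" for m
      using that by (simp add: std_exps_def not_less)
    then show ?thesis unfolding mem_carrier_mpoly_ring disjoint_iff by blast
  qed
  finally show ?thesis .
qed

text \<open>Exponent vectors are 0 outside \<open>{1..n}\<close>, whereas parking functions are
  \<open>undefined\<close> there; restriction translates between the two conventions.\<close>

lemma bij_betw_std_exps:
  "bij_betw (\<lambda>m. restrict (Poly_Mapping.lookup m) {1..n}) (std_exps n lam W)
     {p \<in> {1..n} \<rightarrow>\<^sub>E UNIV. \<exists>\<sigma>\<in>W. \<forall>i\<in>{1..n}. p i < lam (\<sigma> i)}"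
proof (rule bij_betwI')
  fix m m' assume "m \<in> std_exps n lam W" "m' \<in> std_exps n lam W"
  then have out: "Poly_Mapping.lookup m i = 0" "Poly_Mapping.lookup m' i = 0" if "i \<notin> {1..n}" for i
    using that by (auto simp: std_exps_def in_keys_iff)
  show "(restrict (Poly_Mapping.lookup m) {1..n} = restrict (Poly_Mapping.lookup m') {1..n}) = (m = m')"
  proof
    assume *: "restrict (Poly_Mapping.lookup m) {1..n} = restrict (Poly_Mapping.lookup m') {1..n}"
    show "m = m'"
    proof (rule poly_mapping_eqI)
      fix i show "Poly_Mapping.lookup m i = Poly_Mapping.lookup m' i"
        using fun_cong[OF *, of i] out[of i] by (cases "i \<in> {1..n}") auto
    qed
  qed simp
next
  fix m assume "m \<in> std_exps n lam W"
  then show "restrict (Poly_Mapping.lookup m) {1..n} \<in>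
      {p \<in> {1..n} \<rightarrow>\<^sub>E UNIV. \<exists>\<sigma>\<in>W. \<forall>i\<in>{1..n}. p i < lam (\<sigma> i)}"
    by (auto simp: std_exps_def)
next
  fix p assume p: "p \<in> {p \<in> {1..n} \<rightarrow>\<^sub>E UNIV. \<exists>\<sigma>\<in>W. \<forall>i\<in>{1..n}. p i < lam (\<sigma> i)}"
  define m where "m = (\<Sum>i\<in>{1..n}. Poly_Mapping.single i (p i))"
  have m: "Poly_Mapping.lookup m i = (if i \<in> {1..n} then p i else 0)" for i
    by (simp add: m_def lookup_sum lookup_single when_def)
  have "Poly_Mapping.keys m \<subseteq> {1..n}" by (auto simp: in_keys_iff m split: if_splits)
  then have "m \<in> std_exps n lam W" using p by (auto simp: std_exps_def m)
  moreover have "p = restrict (Poly_Mapping.lookup m) {1..n}"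
    using p by (auto simp: m fun_eq_iff PiE_def extensional_def)
  ultimately show "\<exists>m\<in>std_exps n lam W. p = restrict (Poly_Mapping.lookup m) {1..n}" by blast
qed

section \<open>The two counting formulas\<close>

lemma sum_stirling_eq_poly_a_tilde:
  assumes "n \<ge> 1"
  shows "real (\<Sum>r\<le>n. stirling n r * (b ^ (n - r) * (\<Prod>j<r. c + b * j))) =
    poly (a_tilde_poly n b) (real c)"
proof -
  \<comment> \<open>The term for \<open>r = 0\<close> vanishes, since
    \<open>stirling n 0 = 0\<close> for \<open>n \<ge> 1\<close>.\<close>
  have "{..n} = insert 0 {1..n}" by auto
  then have "(\<Sum>r\<le>n. stirling n r * (b ^ (n - r) * (\<Prod>j<r. c + b * j))) =
      (\<Sum>r=1..n. stirling n r * (b ^ (n - r) * (\<Prod>j<r. c + b * j)))"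
    using assms by simp
  then show ?thesis
    by (simp add: a_tilde_poly_def poly_sum poly_prod stirling1_eq_stirling mult_ac add_ac)
qed

text \<open>The quotient of Gamma values is the rising factorial of \<open>c / b\<close>. Of the
  \<open>n\<close> factors \<open>b\<close>, \<open>r\<close> are absorbed into it and turn
  \<open>c / b + j\<close> into \<open>c + j * b\<close>; the other \<open>n - r\<close> stay in
  front.\<close>

lemma poly_a_tilde_eq_Gamma:
  assumes "b \<ge> 1" "c \<ge> 1"
  shows "poly (a_tilde_poly n b) (real c) = real b ^ n * (\<Sum>r=1..n. real (stirling1 n r) *
    (Gamma (real c / real b + real r) / Gamma (real c / real b)))"
proof -
  have "real c / real b > 0" using assms by simp
  then have "real c / real b \<notin> \<int>\<^sub>\<le>\<^sub>0" by (meson not_le nonpos_Ints_nonpos)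
  then have Gamma: "Gamma (real c / real b + real r) / Gamma (real c / real b) =
      (\<Prod>j<r. real c / real b + real j)" for r
    by (simp add: pochhammer_Gamma[symmetric] pochhammer_prod atLeast0LessThan)
  have prod: "real b ^ n * (\<Prod>j<r. real c / real b + real j) =
      real b ^ (n - r) * (\<Prod>j<r. real c + real (j * b))" if "r \<le> n" for r
  proof -
    have "real b ^ n = real b ^ (n - r) * (\<Prod>j<r. real b)"
      using that by (simp flip: power_add)
    then have "real b ^ n * (\<Prod>j<r. real c / real b + real j) =
        real b ^ (n - r) * (\<Prod>j<r. real b * (real c / real b + real j))"
      by (simp add: prod.distrib)
    also have "(\<Prod>j<r. real b * (real c / real b + real j)) = (\<Prod>j<r. real c + real (j * b))"
      using assms by (intro prod.cong) (simp_all add: field_simps)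
    finally show ?thesis .
  qed
  have "real b ^ n * (real (stirling1 n r) * (Gamma (real c / real b + real r) / Gamma (real c / real b))) =
      real (b ^ (n - r) * stirling1 n r) * (\<Prod>j<r. real c + real (j * b))" if "r \<le> n" for r
    unfolding Gamma mult.left_commute[of "real b ^ n"] prod[OF that] by simp
  then show ?thesis
    unfolding a_tilde_poly_def sum_distrib_left poly_sum
    by (intro sum.cong refl) (simp add: poly_prod add.commute)
qed

text \<open>A crude bound on all entries; the resulting finiteness is carried over to the monomial
  basis.\<close>

lemma finite_admissible: "finite {p \<in> {1..n} \<rightarrow>\<^sub>E UNIV. \<exists>U. admissible n b c U p}" (is "finite ?A")
proof (rule finite_subset)
  show "?A \<subseteq> {1..n} \<rightarrow>\<^sub>E {..<c + b * (n + n)}"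
  proof
    fix p assume "p \<in> ?A"
    then obtain U where U: "admissible n b c U p" "p \<in> {1..n} \<rightarrow>\<^sub>E UNIV" by auto
    have "p k < c + b * (n + n)" if k: "k \<in> {1..n}" for k
    proof -
      have "U \<inter> {k<..} \<subseteq> {1..n}" using U(1) by (auto simp: admissible_def)
      then have "card (U \<inter> {k<..}) \<le> n" using card_mono[of "{1..n}"] by fastforce
      then have "b * ((if k \<in> U then 0 else k - 1) + card (U \<inter> {k<..})) \<le> b * (n + n)"
        using k by (intro mult_left_mono add_mono) auto
      moreover have "p k < c + b * ((if k \<in> U then 0 else k - 1) + card (U \<inter> {k<..}))"
        using U(1) k by (auto simp: admissible_def)
      ultimately show ?thesis by linarith
    qed
    with U(2) show "p \<in> {1..n} \<rightarrow>\<^sub>E {..<c + b * (n + n)}" by (auto simp: PiE_iff)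
  qed
qed (auto intro!: finite_PiE)

theorem theorem2:
  fixes n b c u1 :: nat
    and u lam :: "nat \<Rightarrow> nat"
    and J :: "'k::field mpoly set"
  assumes "n \<ge> 1" and "b \<ge> 1" and "c \<ge> 1" and "u1 \<ge> 1"
    and "\<And>i. i \<in> {1..n} \<Longrightarrow> u i = u1 + (i - 1) * b"
    and "\<And>i. i \<in> {1..n} \<Longrightarrow> lam i = u n - u i + c"
    and "J = alexander_dual n (\<lambda>_. u n + c - 1)
               (perm_ideal n (avoiding_perms n {[1, 3, 2], [3, 1, 2]}) u)"
  shows "finite_dim_quot n J \<and>
         real (dim_quot n J) = poly (a_tilde_poly n b) (real c) \<and>
         card (restricted_parking_functions n u c lam) = dim_quot n J \<and>
         real (dim_quot n J) =
           real b ^ n * (\<Sum>r=1..n. real (stirling1 n r) *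
             (Gamma (real c / real b + real r) / Gamma (real c / real b)))"
proof -
  define W where "W = avoiding_perms n {[1, 3, 2], [3, 1, 2]}"
  define S where "S = std_exps n (\<lambda>v. u n + c - 1 + 1 - u v) W"
  define A where "A = {p \<in> {1..n} \<rightarrow>\<^sub>E UNIV. \<exists>U. admissible n b c U p}"
  note u = assms(5)
  have W: "\<sigma> permutes {1..n}" if "\<sigma> \<in> W" for \<sigma>
    using that by (simp add: W_def avoiding_perms_def)
  have u_mono: "u i + b * (n - i) = u n" if "i \<in> {1..n}" for i
  proof -
    have "n - 1 = (i - 1) + (n - i)" using that by auto
    then have "(n - 1) * b = (i - 1) * b + (n - i) * b" by (metis add_mult_distrib)
    then show ?thesis using that assms(1) u[of i] u[of n] by (simp add: mult.commute)
  qed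
  have lam: "lam i = c + b * (n - i)" if "i \<in> {1..n}" for i
    using assms(6)[OF that] u_mono[OF that] by simp
  \<comment> \<open>With \<open>c \<ge> 1\<close> the truncated expression
    \<open>u n + c - 1 + 1\<close> is \<open>u n + c\<close>, so the dual exponents are the bounds
    in terms of \<open>\<sigma>\<close> used for admissible sets.\<close>
  have bound: "u n + c - 1 + 1 - u v = c + b * (n - v)" if "v \<in> {1..n}" for v
    using u_mono[OF that] assms(3) by simp
  have u_bounds: "1 \<le> u i \<and> u i \<le> u n + c - 1" if "i \<in> {1..n}" for i
    using u[OF that] u_mono[OF that] assms(3,4) by linarith
  \<comment> \<open>The standard exponents, read as functions on \<open>{1..n}\<close>, are the
    vectors with an admissible set, and hence the restricted parking functions.\<close>
  have "{p \<in> {1..n} \<rightarrow>\<^sub>E UNIV. \<exists>\<sigma>\<in>W. \<forall>i\<in>{1..n}. p i < u n + c - 1 + 1 - u (\<sigma> i)} = A"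
  proof -
    have "(\<forall>i\<in>{1..n}. p i < u n + c - 1 + 1 - u (\<sigma> i)) \<longleftrightarrow> (\<forall>i\<in>{1..n}. p i < c + b * (n - \<sigma> i))"
      if "\<sigma> \<in> W" for \<sigma> and p :: "nat \<Rightarrow> nat"
      using bound permutes_in_image[OF W[OF that]] by (intro ball_cong) metis+
    then have "(\<exists>\<sigma>\<in>W. \<forall>i\<in>{1..n}. p i < u n + c - 1 + 1 - u (\<sigma> i)) \<longleftrightarrow>
        (\<exists>\<sigma>\<in>W. \<forall>i\<in>{1..n}. p i < c + b * (n - \<sigma> i))" for p
      by (intro bex_cong refl)
    moreover have "(\<exists>\<sigma>\<in>W. \<forall>i\<in>{1..n}. p i < c + b * (n - \<sigma> i)) \<longleftrightarrow> (\<exists>U. admissible n b c U p)" for p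
      using admissible_imp_avoiding_perm avoiding_perm_imp_admissible unfolding W_def by blast
    ultimately have "(\<exists>\<sigma>\<in>W. \<forall>i\<in>{1..n}. p i < u n + c - 1 + 1 - u (\<sigma> i)) \<longleftrightarrow>
        (\<exists>U. admissible n b c U p)" for p
      by blast
    then show ?thesis by (simp add: A_def)
  qed
  then have bij: "bij_betw (\<lambda>m. restrict (Poly_Mapping.lookup m) {1..n}) S A"
    using bij_betw_std_exps[of n "\<lambda>v. u n + c - 1 + 1 - u v" W] by (simp add: S_def)
  have "finite A" unfolding A_def by (rule finite_admissible)
  then have "finite S" using bij bij_betw_finite by blast
  \<comment> \<open>The identity avoids both patterns and all its bounds are at least
    \<open>c\<close>, so the monomial 1 is standard.\<close>
  have "id \<in> W"
    unfolding W_def avoiding_perms_132_312_iff by (auto simp: permutes_id)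
  moreover have "u i < u n + c" if "i \<in> {1..n}" for i
    using u_bounds[OF that] assms(3) by linarith
  ultimately have "0 \<in> S"
    using assms(3) by (auto simp: S_def std_exps_def intro!: bexI[of _ id])
  moreover note \<open>finite S\<close>
  moreover have "p \<in> J \<longleftrightarrow> p \<in> carrier (mpoly_ring n) \<and> Poly_Mapping.keys p \<inter> S = {}" for p
    unfolding assms(7) W_def[symmetric] S_def
    by (rule mem_alexander_dual_perm_ideal_iff[OF W u_bounds])
  moreover have "ideal J (mpoly_ring n)" unfolding assms(7) by (rule ideal_alexander_dual)
  moreover have "Poly_Mapping.keys m \<subseteq> {1..n}" if "m \<in> S" for m
    using that by (simp add: S_def std_exps_def)
  ultimately have dim: "finite_dim_quot n J" "dim_quot n J = card S"
    using dim_quot_monomial_ideal[of J n S] by blast+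
  have card: "dim_quot n J = card A"
    using dim(2) bij_betw_same_card[OF bij] by simp
  moreover have "restricted_parking_functions n u c lam = A"
    unfolding A_def by (rule restricted_parking_functions_eq[OF u lam])
  moreover have "real (card A) = poly (a_tilde_poly n b) (real c)"
    unfolding A_def card_admissible by (rule sum_stirling_eq_poly_a_tilde[OF assms(1)])
  ultimately show ?thesis
    using dim(1) poly_a_tilde_eq_Gamma[OF assms(2,3)] by simp
qed

end
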